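(* There is an $O(1)$-round algorithm in the $\mathsf{CONGESTED}\text{-}\mathsf{CLIQUE}$ model that solves the $(\Delta+1)$-list coloring problem on any $n$-vertex graph of maximum degree $\Delta$, with success probability $1 - 1/\mathrm{poly}(n)$.
   Context: The $(\Delta+1)$-list coloring problem: given a graph $G=(V,E)$ with maximum degree $\Delta$, where each vertex $v$ has a list (palette) $\Psi(v)$ of colors with $|\Psi(v)| = \Delta+1$, find a proper vertex coloring in which each $v$ receives a color from $\Psi(v)$ and adjacent vertices receive different colors. The $\mathsf{CONGESTED}\text{-}\mathsf{CLIQUE}$ model: there are $n=|V|$ processors, one per vertex, each with a unique $\Theta(\log n)$-bit ID and private random bits; initially each vertex knows its incident edges in $G$ (and its list). Computation proceeds in synchronous rounds; in each round each vertex may send a (possibly different) $O(\log n)$-bit message to every other vertex (all-to-all communication, independent of $G$), with unbounded local computation. At the end each vertex outputs its color. Colors may be assumed representable in $O(\log n)$ bits. *)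

theory Defs
  imports "HOL-Probability.Probability"
begin

text \<open>
  A finite simple graph is given by a vertex set and a set of two-element edges. The vertices
  are natural numbers and serve as their own identifiers.
\<close>

definition simple_graph :: "nat set \<Rightarrow> nat set set \<Rightarrow> bool" where
  "simple_graph V E \<longleftrightarrow> finite V \<and> V \<noteq> {} \<and> (\<forall>e\<in>E. e \<subseteq> V \<and> card e = 2)"

definition neighbours :: "nat set set \<Rightarrow> nat \<Rightarrow> nat set" where
  "neighbours E v = {u. {u, v} \<in> E}"

definition max_degree :: "nat set \<Rightarrow> nat set set \<Rightarrow> nat" where
  "max_degree V E = Max ((\<lambda>v. card (neighbours E v)) ` V)"

definition proper_list_colouring ::
  "nat set \<Rightarrow> nat set set \<Rightarrow> (nat \<Rightarrow> nat set) \<Rightarrow> (nat \<Rightarrow> nat) \<Rightarrow> bool" where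
  "proper_list_colouring V E \<Psi> c \<longleftrightarrow>
     (\<forall>v\<in>V. c v \<in> \<Psi> v) \<and> (\<forall>u v. {u, v} \<in> E \<longrightarrow> c u \<noteq> c v)"

text \<open>
  The unit in which O(log n) bit lengths are measured; n + 1 in place of n keeps it positive
  for n = 1.
\<close>

definition log_bits :: "nat \<Rightarrow> nat" where
  "log_bits n = nat \<lceil>log 2 (real n + 1)\<rceil>"

text \<open>
  An input of the list colouring problem with identifiers of at most a * log_bits n bits and
  colours of at most b * log_bits n bits. (That n distinct identifiers need at least log n bits
  is automatic.)
\<close>

definition list_colouring_input ::
  "nat \<Rightarrow> nat \<Rightarrow> nat set \<Rightarrow> nat set set \<Rightarrow> (nat \<Rightarrow> nat set) \<Rightarrow> bool" where
  "list_colouring_input a b V E \<Psi> \<longleftrightarrow>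
     simple_graph V E \<and>
     (\<forall>v\<in>V. v < 2 ^ (a * log_bits (card V))) \<and>
     (\<forall>v\<in>V. card (\<Psi> v) = max_degree V E + 1 \<and>
             (\<forall>x\<in>\<Psi> v. x < 2 ^ (b * log_bits (card V))))"

text \<open>
  What a processor has received in one round: the message of each sender, indexed by the
  identifier of the sender, and None at identifiers that do not belong to another processor.
\<close>

type_synonym inbox = "nat \<Rightarrow> bool list option"

text \<open>
  Everything a processor knows after some number of rounds. As local memory and computation are
  unbounded, the state of a processor may be taken to be its whole history: its initial
  knowledge, its private random bits, and its inboxes so far, oldest first.
\<close>

record knowledge =
  num_verts :: nat
  own_id :: nat
  nbrs :: "nat set"
  palette :: "nat set"
  random_bits :: "nat \<Rightarrow> bool"
  inboxes :: "inbox list"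

text \<open>
  All processors run the same algorithm. The message for a given recipient depends on the
  knowledge of the sender and on the identifier of the recipient. Local computation being
  unbounded, both components are arbitrary functions.
\<close>

record algorithm =
  message :: "knowledge \<Rightarrow> nat \<Rightarrow> bool list"
  final_colour :: "knowledge \<Rightarrow> nat"

definition knowledge_of ::
  "nat set \<Rightarrow> nat set set \<Rightarrow> (nat \<Rightarrow> nat set) \<Rightarrow> (nat \<Rightarrow> nat \<Rightarrow> bool) \<Rightarrow> nat \<Rightarrow> inbox list \<Rightarrow> knowledge" where
  "knowledge_of V E \<Psi> \<omega> v h =
     \<lparr>num_verts = card V, own_id = v, nbrs = neighbours E v, palette = \<Psi> v,
      random_bits = \<omega> v, inboxes = h\<rparr>"

text \<open>
  The inboxes of v in the first t rounds. Communication is all-to-all: the senders range over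
  all of V, irrespective of E.
\<close>

primrec received ::
  "algorithm \<Rightarrow> nat set \<Rightarrow> nat set set \<Rightarrow> (nat \<Rightarrow> nat set) \<Rightarrow> (nat \<Rightarrow> nat \<Rightarrow> bool) \<Rightarrow>
   nat \<Rightarrow> nat \<Rightarrow> inbox list" where
  "received A V E \<Psi> \<omega> 0 v = []"
| "received A V E \<Psi> \<omega> (Suc t) v =
     received A V E \<Psi> \<omega> t v @
     [\<lambda>u. if u \<in> V \<and> u \<noteq> v
          then Some (message A (knowledge_of V E \<Psi> \<omega> u (received A V E \<Psi> \<omega> t u)) v)
          else None]"

definition outcome ::
  "algorithm \<Rightarrow> nat \<Rightarrow> nat set \<Rightarrow> nat set set \<Rightarrow> (nat \<Rightarrow> nat set) \<Rightarrow> (nat \<Rightarrow> nat \<Rightarrow> bool) \<Rightarrow>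
   nat \<Rightarrow> nat" where
  "outcome A R V E \<Psi> \<omega> v =
     final_colour A (knowledge_of V E \<Psi> \<omega> v (received A V E \<Psi> \<omega> R v))"

definition bandwidth_at_most :: "algorithm \<Rightarrow> nat \<Rightarrow> bool" where
  "bandwidth_at_most A B \<longleftrightarrow>
     (\<forall>K u. length (message A K u) \<le> B * log_bits (num_verts K))"

text \<open>
  Each vertex has its own infinite sequence of fair bits, all of them independent.
\<close>

definition coin_space :: "nat set \<Rightarrow> (nat \<Rightarrow> nat \<Rightarrow> bool) measure" where
  "coin_space V =
     (\<Pi>\<^sub>M v\<in>V. \<Pi>\<^sub>M i\<in>(UNIV :: nat set). measure_pmf (bernoulli_pmf (1 / 2)))"

end

theory Submission
  imports Defs "HOL-Real_Asymp.Real_Asymp"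
begin

text \<open>
  The algorithm is deterministic. Let \<open>r\<close> be about the sixth root of the maximum degree. A hash
  function distributes the vertices and the colours over \<open>r^3\<close> bins, except that a fraction \<open>1/r\<close> of
  the vertices is left over. This makes the degree of a typical vertex inside its bin smaller
  than the number of its colours that fall into the bin, so every bin is a list colouring problem
  of its own. It has about \<open>n / r^3\<close> vertices of degree about \<open>r^3\<close>, thus it fits into \<open>O(n)\<close> words and
  is solved greedily by one processor. The leftover vertices form an instance in which the number
  of vertices and the degrees are smaller by a factor \<open>r\<close>; it is treated in the same way with \<open>r^2\<close>
  bins, and then once more with \<open>r\<close> bins. What remains after that, and the \<open>O(n / r^6)\<close> vertices
  for which some hash function failed, consist of \<open>O(n)\<close> words each. If the maximum degree is
  bounded, then the whole input consists of \<open>O(n)\<close> words.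

  The hash functions are taken from a family of polynomial size, which exists by the
  probabilistic method: for every possible neighbourhood and palette only few members of the family
  fail. A member that fails at few vertices of the given graph is then found by the method of
  conditional expectations, in a constant number of rounds.
\<close>

section \<open>Functions computable in a constant number of rounds\<close>

text \<open>Write \<Delta> for the maximum degree and q for the number of bins of the first level.
  Two demands lead to the sixth root. A bin holds about n/q vertices of degree about \<Delta>/q, so
  O(n) words per bin require q to be at least about the square root of \<Delta>. A bin then receives
  about \<Delta>/q colours of a palette; their advantage over the neighbours is only a fraction 1/r
  of this, which exceeds the random fluctuation if \<Delta>/q is large compared with r^2. With
  \<Delta> about r^6 and q = r^3 the failure probability is exponentially small in r, hence below
  1/\<Delta> for large r, so that failing vertices can afford to send their full neighbourhoods.
  Each level divides both the number of vertices and the degrees by about r, so three levels shrink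
  n * r^6 words to O(n).

  A further obstacle is that the tail bounds need large palettes on every level. A vertex keeps
  enough colours because either many of its neighbours are left over, or its palette was more than
  twice its degree. Finally, an arbitrary hash function is too long for a message, whereas a seed
  consisting of a constant number of identifiers is not.\<close>

type_synonym input = "nat set \<times> nat set set \<times> (nat \<Rightarrow> nat set)"

definition verts :: "input \<Rightarrow> nat set" where "verts I = fst I"
definition nbhd :: "input \<Rightarrow> nat \<Rightarrow> nat set" where "nbhd I v = neighbours (fst (snd I)) v"
definition pal :: "input \<Rightarrow> nat \<Rightarrow> nat set" where "pal I v = snd (snd I) v"

definition view :: "algorithm \<Rightarrow> nat \<Rightarrow> input \<Rightarrow> (nat \<Rightarrow> nat \<Rightarrow> bool) \<Rightarrow> nat \<Rightarrow> knowledge" where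
  "view A R I \<omega> v =
     knowledge_of (fst I) (fst (snd I)) (snd (snd I)) \<omega> v
       (received A (fst I) (fst (snd I)) (snd (snd I)) \<omega> R v)"

text \<open>R and B are uniform over \<open>\<I>\<close>, so a constant number of rounds is built
  in, and the result has to be the same for all coins. As memory and local computation are
  unlimited, results have arbitrary type and post-processing is free. A result that does not depend
  on the vertex is common knowledge.\<close>

definition computable :: "input set \<Rightarrow> (input \<Rightarrow> nat \<Rightarrow> 's) \<Rightarrow> bool" where
  "computable \<I> F \<longleftrightarrow> (\<exists>A R B g. bandwidth_at_most A B \<and>
     (\<forall>I\<in>\<I>. \<forall>\<omega>. \<forall>v\<in>verts I. g (view A R I \<omega> v) = F I v))"

lemma length_received [simp]: "length (received A V E \<Psi> \<omega> t v) = t"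
  by (induction t) auto

lemma computable_local:
  assumes "\<And>I \<omega> v. I \<in> \<I> \<Longrightarrow> v \<in> verts I \<Longrightarrow>
    g (knowledge_of (fst I) (fst (snd I)) (snd (snd I)) \<omega> v []) = F I v"
  shows "computable \<I> F"
proof -
  define A where "A = \<lparr>message = (\<lambda>_ _. []), final_colour = (\<lambda>_. 0)\<rparr>"
  have "bandwidth_at_most A 0" by (simp add: bandwidth_at_most_def A_def)
  moreover have "\<forall>I\<in>\<I>. \<forall>\<omega>. \<forall>v\<in>verts I. g (view A 0 I \<omega> v) = F I v"
    using assms by (simp add: view_def)
  ultimately show ?thesis unfolding computable_def by blast
qed

lemma computable_const: "computable \<I> (\<lambda>I v. k)"
  by (rule computable_local[where g = "\<lambda>_. k"]) simp

lemma computable_id: "computable \<I> (\<lambda>I v. v)"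
  by (rule computable_local[where g = own_id]) (simp add: knowledge_of_def)

lemma computable_nbhd: "computable \<I> nbhd"
  by (rule computable_local[where g = nbrs]) (simp add: knowledge_of_def nbhd_def)

lemma computable_pal: "computable \<I> pal"
  by (rule computable_local[where g = palette]) (simp add: knowledge_of_def pal_def)

lemma computable_map:
  assumes "computable \<I> F"
  shows "computable \<I> (\<lambda>I v. h (F I v))"
proof -
  obtain A R B g where *: "bandwidth_at_most A B"
    "\<forall>I\<in>\<I>. \<forall>\<omega>. \<forall>v\<in>verts I. g (view A R I \<omega> v) = F I v"
    using assms unfolding computable_def by blast
  then have "\<forall>I\<in>\<I>. \<forall>\<omega>. \<forall>v\<in>verts I. (h \<circ> g) (view A R I \<omega> v) = h (F I v)" by simp
  with * show ?thesis unfolding computable_def by blast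
qed

lemma computable_cong:
  assumes "computable \<I> F" "\<And>I v. I \<in> \<I> \<Longrightarrow> v \<in> verts I \<Longrightarrow> F I v = G I v"
  shows "computable \<I> G"
  using assms unfolding computable_def by (metis (no_types, lifting))

section \<open>Running algorithms one after the other\<close>

definition sequential :: "algorithm \<Rightarrow> nat \<Rightarrow> algorithm \<Rightarrow> algorithm" where
  "sequential A1 R A2 =
     \<lparr>message = (\<lambda>K u. if length (inboxes K) < R then message A1 K u
                else message A2 (K\<lparr>inboxes := drop R (inboxes K)\<rparr>) u),
      final_colour = (\<lambda>_. 0)\<rparr>"

lemma received_cong:
  assumes "\<And>K u. length (inboxes K) < R \<Longrightarrow> message A K u = message A' K u" "t \<le> R"
  shows "received A V E \<Psi> \<omega> t v = received A' V E \<Psi> \<omega> t v"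
  using assms(2)
proof (induction t arbitrary: v)
  case (Suc t)
  then have IH: "received A V E \<Psi> \<omega> t = received A' V E \<Psi> \<omega> t" by (intro ext) simp
  show ?case using Suc.prems
    by (auto simp: IH fun_eq_iff knowledge_of_def intro!: assms(1))
qed simp

lemma received_sequential:
  "received (sequential A1 R A2) V E \<Psi> \<omega> (R + t) v =
     received A1 V E \<Psi> \<omega> R v @ received A2 V E \<Psi> \<omega> t v"
proof (induction t arbitrary: v)
  case 0
  show ?case using received_cong[of R "sequential A1 R A2" A1 R] by (simp add: sequential_def)
next
  case (Suc t)
  have IH: "received (sequential A1 R A2) V E \<Psi> \<omega> (R + t) =
     (\<lambda>v. received A1 V E \<Psi> \<omega> R v @ received A2 V E \<Psi> \<omega> t v)"
    using Suc.IH by (intro ext)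
  show ?case by (simp add: IH cong: if_cong) (simp add: sequential_def knowledge_of_def cong: if_cong)
qed

lemma view_sequential:
  shows "(view (sequential A1 R A2) (R + t) I \<omega> v)\<lparr>inboxes :=
           take R (inboxes (view (sequential A1 R A2) (R + t) I \<omega> v))\<rparr> = view A1 R I \<omega> v"
    and "(view (sequential A1 R A2) (R + t) I \<omega> v)\<lparr>inboxes :=
           drop R (inboxes (view (sequential A1 R A2) (R + t) I \<omega> v))\<rparr> = view A2 t I \<omega> v"
  by (simp_all add: view_def received_sequential knowledge_of_def)

lemma bandwidth_sequential:
  assumes "bandwidth_at_most A1 B1" "bandwidth_at_most A2 B2"
  shows "bandwidth_at_most (sequential A1 R A2) (B1 + B2)"
  unfolding bandwidth_at_most_def
proof (intro allI)
  fix K :: knowledge and u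
  let ?K = "K\<lparr>inboxes := drop R (inboxes K)\<rparr>"
  have "length (message A1 K u) \<le> B1 * log_bits (num_verts K)"
    "length (message A2 ?K u) \<le> B2 * log_bits (num_verts K)"
    using assms(1)[unfolded bandwidth_at_most_def, rule_format, of K u]
      assms(2)[unfolded bandwidth_at_most_def, rule_format, of ?K u] by simp_all
  then show "length (message (sequential A1 R A2) K u) \<le> (B1 + B2) * log_bits (num_verts K)"
    by (auto simp: sequential_def algebra_simps)
qed

text \<open>The second algorithm is shown only the inboxes that arrive after round
  \<open>R1\<close>, so it starts afresh. Cutting the recorded history at \<open>R1\<close> recovers
  both views.\<close>

lemma computable_pair:
  assumes "computable \<I> F" "computable \<I> G"
  shows "computable \<I> (\<lambda>I v. (F I v, G I v))"
proof -
  obtain A1 R1 B1 g1 where 1: "bandwidth_at_most A1 B1"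
    "\<And>I \<omega> v. I\<in>\<I> \<Longrightarrow> v\<in>verts I \<Longrightarrow> g1 (view A1 R1 I \<omega> v) = F I v"
    using assms(1) unfolding computable_def by blast
  obtain A2 R2 B2 g2 where 2: "bandwidth_at_most A2 B2"
    "\<And>I \<omega> v. I\<in>\<I> \<Longrightarrow> v\<in>verts I \<Longrightarrow> g2 (view A2 R2 I \<omega> v) = G I v"
    using assms(2) unfolding computable_def by blast
  define g where "g K = (g1 (K\<lparr>inboxes := take R1 (inboxes K)\<rparr>),
                         g2 (K\<lparr>inboxes := drop R1 (inboxes K)\<rparr>))" for K
  have "\<forall>I\<in>\<I>. \<forall>\<omega>. \<forall>v\<in>verts I.
      g (view (sequential A1 R1 A2) (R1 + R2) I \<omega> v) = (F I v, G I v)"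
    by (simp only: g_def view_sequential) (simp add: 1 2)
  with bandwidth_sequential[OF 1(1) 2(1)] show ?thesis unfolding computable_def by blast
qed

lemma computable_map2:
  assumes "computable \<I> F" "computable \<I> G"
  shows "computable \<I> (\<lambda>I v. h (F I v) (G I v))"
  using computable_map[OF computable_pair[OF assms], of "\<lambda>(x, y). h x y"] by simp

lemma computable_map3:
  assumes "computable \<I> F" "computable \<I> G" "computable \<I> H"
  shows "computable \<I> (\<lambda>I v. h (F I v) (G I v) (H I v))"
  using computable_map2[OF assms(1) computable_pair[OF assms(2,3)], of "\<lambda>x (y, z). h x y z"] by simp

lemma computable_map4:
  assumes "computable \<I> F" "computable \<I> G" "computable \<I> H" "computable \<I> J"
  shows "computable \<I> (\<lambda>I v. h (F I v) (G I v) (H I v) (J I v))"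
  using computable_map3[OF assms(1,2) computable_pair[OF assms(3,4)], of "\<lambda>x y (z, w). h x y z w"]
  by simp

text \<open>Fixing all random bits keeps the result a function of the input also outside \<open>\<I>\<close>.\<close>

lemma computable_extend:
  assumes "computable \<I> F"
  shows "\<exists>F'. computable UNIV F' \<and> (\<forall>I\<in>\<I>. \<forall>v\<in>verts I. F' I v = F I v)"
proof -
  obtain A R B g where *: "bandwidth_at_most A B"
    "\<And>I \<omega> v. I\<in>\<I> \<Longrightarrow> v\<in>verts I \<Longrightarrow> g (view A R I \<omega> v) = F I v"
    using assms unfolding computable_def by blast
  define z :: "nat \<Rightarrow> nat \<Rightarrow> bool" where "z = (\<lambda>_ _. False)"
  define A' where "A' = A\<lparr>message := \<lambda>K. message A (K\<lparr>random_bits := \<lambda>_. False\<rparr>)\<rparr>"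
  have msg: "message A' (knowledge_of V E \<Psi> \<omega> u h) = message A (knowledge_of V E \<Psi> z u h)"
    for V E \<Psi> \<omega> u h by (simp add: A'_def z_def knowledge_of_def)
  have rec: "received A' V E \<Psi> \<omega> t = received A V E \<Psi> z t" for V E \<Psi> \<omega> t
  proof (induction t)
    case (Suc t)
    show ?case by (intro ext) (simp add: Suc.IH msg cong: if_cong)
  qed auto
  have view: "(view A' R I \<omega> v)\<lparr>random_bits := \<lambda>_. False\<rparr> = view A R I z v" for I \<omega> v
    by (simp add: view_def rec) (simp add: knowledge_of_def z_def)
  have "bandwidth_at_most A' B"
    unfolding bandwidth_at_most_def
  proof (intro allI)
    fix K :: knowledge and u
    show "length (message A' K u) \<le> B * log_bits (num_verts K)"
      using *(1)[unfolded bandwidth_at_most_def, rule_format, of "K\<lparr>random_bits := \<lambda>_. False\<rparr>" u]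
      by (simp add: A'_def)
  qed
  then have "computable UNIV (\<lambda>I v. g (view A R I z v))"
    unfolding computable_def
    by (intro exI[of _ A'] exI[of _ R] exI[of _ B]
        exI[of _ "\<lambda>K. g (K\<lparr>random_bits := \<lambda>_. False\<rparr>)"]) (simp add: view)
  with *(2) show ?thesis by blast
qed

lemma computable_subset:
  assumes "computable \<I> F" "\<J> \<subseteq> \<I>"
  shows "computable \<J> F"
  using assms unfolding computable_def by (meson subsetD)

text \<open>Both algorithms are run on every input, after extension beyond their domains; the
  membership test \<open>dec\<close> then selects the right result locally.\<close>

lemma computable_Un:
  assumes "computable \<I> F" "computable \<J> F"
    and dec: "computable (\<I> \<union> \<J>) (\<lambda>I v. I \<in> \<I>)"
  shows "computable (\<I> \<union> \<J>) F"
proof -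
  obtain F1 where 1: "computable UNIV F1" "\<forall>I\<in>\<I>. \<forall>v\<in>verts I. F1 I v = F I v"
    using computable_extend[OF assms(1)] by blast
  obtain F2 where 2: "computable UNIV F2" "\<forall>I\<in>\<J>. \<forall>v\<in>verts I. F2 I v = F I v"
    using computable_extend[OF assms(2)] by blast
  have "computable (\<I> \<union> \<J>) (\<lambda>I v. if I \<in> \<I> then F1 I v else F2 I v)"
    using computable_map3[OF dec computable_subset[OF 1(1) subset_UNIV]
        computable_subset[OF 2(1) subset_UNIV], of "\<lambda>p x y. if p then x else y"] .
  then show ?thesis
    by (rule computable_cong) (use 1 2 in auto)
qed

section \<open>Message sets of polynomial size\<close>

lemma less_two_power_log_bits: "n < 2 ^ log_bits n"
proof -
  have "real n + 1 = 2 powr (log 2 (real n + 1))" by simp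
  also have "\<dots> \<le> 2 powr real (log_bits n)"
    unfolding log_bits_def by (intro powr_mono) linarith+
  also have "\<dots> = 2 ^ log_bits n" by (simp add: powr_realpow)
  finally have "real n + 1 \<le> 2 ^ log_bits n" .
  then have "real (n + 1) \<le> real (2 ^ log_bits n)" by simp
  then show ?thesis by (simp only: of_nat_le_iff)
qed

lemma log_bits_pos: "0 < n \<Longrightarrow> 0 < log_bits n"
  using less_two_power_log_bits[of n] by (cases "log_bits n") auto

text \<open>The sets whose elements fit into one message: cardinality 2^O(log n) is what an
  injective encoding by O(log n) bits requires.\<close>

definition small :: "(nat \<Rightarrow> 'm set) \<Rightarrow> bool" where
  "small S \<longleftrightarrow> (\<exists>B. \<forall>n>0. finite (S n) \<and> card (S n) \<le> 2 ^ (B * log_bits n))"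

lemma small_words: "small (\<lambda>n. {..<2 ^ (w * log_bits n) :: nat})"
  unfolding small_def by (intro exI[of _ w]) auto

lemma small_poly: "small (\<lambda>n. {..k * n ^ c :: nat})"
  unfolding small_def
proof (intro exI[of _ "k + c + 1"] allI impI conjI)
  fix n :: nat assume n: "0 < n"
  let ?l = "log_bits n"
  have l: "1 \<le> ?l" using log_bits_pos[OF n] by simp
  have "k < 2 ^ k" by (rule less_exp)
  also have "(2::nat) ^ k \<le> 2 ^ (k * ?l)" using l by (intro power_increasing) auto
  finally have k: "k \<le> 2 ^ (k * ?l)" by simp
  have "n ^ c \<le> (2 ^ ?l) ^ c" using less_two_power_log_bits[of n] by (intro power_mono) auto
  also have "\<dots> = 2 ^ (c * ?l)" by (simp add: power_mult[symmetric] mult.commute)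
  finally have "k * n ^ c \<le> 2 ^ (k * ?l) * 2 ^ (c * ?l)" using k by (intro mult_mono) auto
  moreover have "(1::nat) \<le> 2 ^ (k * ?l) * 2 ^ (c * ?l)" by simp
  \<comment> \<open>The set contains 0 as well; this additional element is paid for by one more
    factor 2.\<close>
  ultimately have "k * n ^ c + 1 \<le> 2 ^ (k * ?l) * 2 ^ (c * ?l) * 2" by linarith
  also have "\<dots> \<le> 2 ^ (k * ?l) * 2 ^ (c * ?l) * 2 ^ ?l"
    using power_increasing[OF l, of "2::nat"] by (intro mult_left_mono) auto
  also have "\<dots> = 2 ^ ((k + c + 1) * ?l)" by (simp add: power_add algebra_simps)
  finally show "card {..k * n ^ c} \<le> 2 ^ ((k + c + 1) * ?l)" by simp
qed auto

lemma small_bool: "small (\<lambda>n. UNIV :: bool set)"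
  unfolding small_def
proof (intro exI[of _ 1] allI impI conjI)
  fix n :: nat assume "0 < n"
  then have "1 \<le> log_bits n" using log_bits_pos[of n] by simp
  then have "(2::nat) ^ 1 \<le> 2 ^ log_bits n" by (intro power_increasing) auto
  then show "card (UNIV :: bool set) \<le> 2 ^ (1 * log_bits n)" by simp
qed auto

lemma small_unit: "small (\<lambda>n. UNIV :: unit set)"
  unfolding small_def by (intro exI[of _ 0]) auto

lemma small_Times:
  assumes "small S" "small T"
  shows "small (\<lambda>n. S n \<times> T n)"
proof -
  obtain B1 where 1: "\<forall>n>0. finite (S n) \<and> card (S n) \<le> 2 ^ (B1 * log_bits n)"
    using assms(1) unfolding small_def by blast
  obtain B2 where 2: "\<forall>n>0. finite (T n) \<and> card (T n) \<le> 2 ^ (B2 * log_bits n)"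
    using assms(2) unfolding small_def by blast
  show ?thesis unfolding small_def
    by (intro exI[of _ "B1 + B2"])
      (use 1 2 in \<open>auto simp: card_cartesian_product algebra_simps power_add intro!: mult_mono\<close>)
qed

text \<open>A set of at most c words is listed by a sequence of length at most c. With c constant,
  one message can therefore carry several routed items.\<close>

lemma small_subsets:
  assumes "small S"
  shows "small (\<lambda>n. {X. X \<subseteq> S n \<and> card X \<le> c})"
proof -
  obtain B where B: "\<forall>n>0. finite (S n) \<and> card (S n) \<le> 2 ^ (B * log_bits n)"
    using assms(1) unfolding small_def by blast
  show ?thesis unfolding small_def
  proof (intro exI[of _ "c + B * c"] allI impI conjI)
    fix n :: nat assume n: "0 < n"
    let ?l = "log_bits n"
    have fin: "finite (S n)" and cS: "card (S n) \<le> 2 ^ (B * ?l)" using B n by auto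
    then show "finite {X. X \<subseteq> S n \<and> card X \<le> c}" by auto
    have l: "1 \<le> ?l" using log_bits_pos[OF n] by simp
    have sub: "{X. X \<subseteq> S n \<and> card X \<le> c} \<subseteq> set ` {xs. set xs \<subseteq> S n \<and> length xs \<le> c}"
    proof
      fix X assume X: "X \<in> {X. X \<subseteq> S n \<and> card X \<le> c}"
      then have "finite X" using fin finite_subset by auto
      then obtain xs where "set xs = X" "distinct xs" using finite_distinct_list by blast
      then show "X \<in> set ` {xs. set xs \<subseteq> S n \<and> length xs \<le> c}"
        using X distinct_card[of xs] by auto
    qed
    have "card {X. X \<subseteq> S n \<and> card X \<le> c} \<le> card {xs. set xs \<subseteq> S n \<and> length xs \<le> c}"
      using sub finite_lists_length_le[OF fin] by (meson card_image_le card_mono finite_imageI le_trans)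
    also have "\<dots> = (\<Sum>i\<le>c. card (S n) ^ i)" by (rule card_lists_length_le[OF fin])
    also have "\<dots> \<le> (\<Sum>i\<le>c. 2 ^ (B * c * ?l))"
    proof (rule sum_mono)
      fix i assume "i \<in> {..c}"
      then have i: "i \<le> c" by simp
      have "card (S n) ^ i \<le> (2 ^ (B * ?l)) ^ i" using cS by (rule power_mono) simp
      also have "\<dots> \<le> (2 ^ (B * ?l)) ^ c" using i by (intro power_increasing) auto
      also have "\<dots> = 2 ^ (B * c * ?l)" by (simp add: power_mult[symmetric] algebra_simps)
      finally show "card (S n) ^ i \<le> 2 ^ (B * c * ?l)" .
    qed
    also have "\<dots> = Suc c * 2 ^ (B * c * ?l)" by simp
    also have "\<dots> \<le> 2 ^ (c * ?l) * 2 ^ (B * c * ?l)"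
    proof (rule mult_right_mono)
      have "Suc c \<le> 2 ^ c" using less_exp[of c] by (rule Suc_leI)
      also have "(2::nat) ^ c \<le> 2 ^ (c * ?l)" using l by (intro power_increasing) auto
      finally show "Suc c \<le> 2 ^ (c * ?l)" .
    qed simp
    also have "\<dots> = 2 ^ ((c + B * c) * ?l)" by (simp add: power_add algebra_simps)
    finally show "card {X. X \<subseteq> S n \<and> card X \<le> c} \<le> 2 ^ ((c + B * c) * ?l)" .
  qed
qed

lemma ex_encoding:
  assumes "finite S" "card S \<le> 2 ^ L"
  shows "\<exists>f :: 'm \<Rightarrow> bool list. inj_on f S \<and> (\<forall>x\<in>S. length (f x) \<le> L)"
proof -
  let ?T = "{xs :: bool list. set xs \<subseteq> UNIV \<and> length xs = L}"
  have "finite ?T" by (rule finite_lists_length_eq) simp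
  moreover have "card ?T = 2 ^ L" using card_lists_length_eq[of "UNIV :: bool set" L] by simp
  ultimately obtain f where "f ` S \<subseteq> ?T" "inj_on f S"
    using card_le_inj[OF assms(1), of ?T] assms(2) by auto
  then show ?thesis by (intro exI[of _ f]) auto
qed

section \<open>All-to-all communication\<close>

definition admissible :: "nat \<Rightarrow> input set \<Rightarrow> bool" where
  "admissible a \<I> \<longleftrightarrow>
     (\<forall>I\<in>\<I>. finite (verts I) \<and> verts I \<noteq> {} \<and> verts I \<subseteq> {..<2 ^ (a * log_bits (card (verts I)))})"

lemma admissibleD:
  assumes "admissible a \<I>" "I \<in> \<I>"
  shows "finite (verts I)" "verts I \<noteq> {}" "0 < card (verts I)"
    "verts I \<subseteq> {..<2 ^ (a * log_bits (card (verts I)))}"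
  using assms unfolding admissible_def by (auto simp: card_gt_0_iff)

lemma computable_exchange_option:
  assumes adm: "admissible a \<I>" and "small S" and F: "computable \<I> F"
    and mem: "\<And>I v u. I \<in> \<I> \<Longrightarrow> v \<in> verts I \<Longrightarrow> u \<in> verts I \<Longrightarrow> F I v u \<in> S (card (verts I))"
  shows "computable \<I> (\<lambda>I u v. if v \<in> verts I then Some (F I v u) else None)"
proof -
  obtain A R B g where A: "bandwidth_at_most A B"
    "\<And>I \<omega> v. I\<in>\<I> \<Longrightarrow> v\<in>verts I \<Longrightarrow> g (view A R I \<omega> v) = F I v"
    using F unfolding computable_def by blast
  obtain B' where B': "\<And>n. 0 < n \<Longrightarrow> finite (S n) \<and> card (S n) \<le> 2 ^ (B' * log_bits n)"
    using assms(2) unfolding small_def by blast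
  have "\<forall>n. \<exists>f :: _ \<Rightarrow> bool list. 0 < n \<longrightarrow>
      inj_on f (S n) \<and> (\<forall>x\<in>S n. length (f x) \<le> B' * log_bits n)"
    using ex_encoding B' by blast
  then obtain enc :: "nat \<Rightarrow> _ \<Rightarrow> bool list" where enc: "\<And>n. 0 < n \<Longrightarrow> inj_on (enc n) (S n)"
    "\<And>n x. 0 < n \<Longrightarrow> x \<in> S n \<Longrightarrow> length (enc n x) \<le> B' * log_bits n"
    by metis
  \<comment> \<open>The truncation enforces the bandwidth for arbitrary knowledge, also for
    knowledge that arises from no input. On actual encodings it changes nothing.\<close>
  define C where "C = \<lparr>message = (\<lambda>K u. if length (inboxes K) < R then message A K u
      else take (B' * log_bits (num_verts K)) (enc (num_verts K) (g K u))),
      final_colour = (\<lambda>_. 0)\<rparr>"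
  \<comment> \<open>A processor has no inbox entry from itself, so it evaluates its own entry
    directly.\<close>
  define h where "h K = (let K0 = K\<lparr>inboxes := take R (inboxes K)\<rparr>; b = inboxes K ! R in
      (\<lambda>u. if u = own_id K then Some (g K0 u)
           else map_option (inv_into (S (num_verts K)) (enc (num_verts K))) (b u)))" for K
  have "bandwidth_at_most C (B + B')"
    using A(1) by (fastforce simp: bandwidth_at_most_def C_def algebra_simps intro: le_trans)
  moreover have "h (view C (Suc R) I \<omega> u) = (\<lambda>v. if v \<in> verts I then Some (F I v u) else None)"
    if I: "I \<in> \<I>" and u: "u \<in> verts I" for I \<omega> u
  proof
    fix v
    let ?n = "card (verts I)"
    have n: "0 < ?n" using admissibleD[OF adm I] by simp
    have rec: "received C V E \<Psi> \<omega> R = received A V E \<Psi> \<omega> R" for V E \<Psi>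
      by (intro ext received_cong) (auto simp: C_def)
    let ?K = "\<lambda>v. view A R I \<omega> v"
    have view: "view C (Suc R) I \<omega> u = (?K u)\<lparr>inboxes := inboxes (?K u) @
        [\<lambda>v. if v \<in> verts I \<and> v \<noteq> u then Some (message C (?K v) u) else None]\<rparr>"
      by (simp add: view_def rec knowledge_of_def verts_def cong: if_cong)
    have len: "length (inboxes (?K w)) = R" for w by (simp add: view_def knowledge_of_def)
    have own: "own_id (?K w) = w" "num_verts (?K w) = ?n" for w
      by (simp_all add: view_def knowledge_of_def verts_def)
    have msg: "message C (?K v) u = enc ?n (F I v u)" if v: "v \<in> verts I"
      using enc(2)[OF n mem[OF I v u]] A(2)[OF I v, of \<omega>] by (simp add: C_def len own)
    have K0: "(?K u)\<lparr>inboxes := inboxes (?K u)\<rparr> = ?K u" by simp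
    show "h (view C (Suc R) I \<omega> u) v = (if v \<in> verts I then Some (F I v u) else None)"
    proof (cases "v = u")
      case True
      then show ?thesis using A(2)[OF I u, of \<omega>] u by (simp add: h_def view len own)
    next
      case False
      then show ?thesis using msg inv_into_f_f[OF enc(1)[OF n] mem[OF I _ u, of v]]
        by (auto simp: h_def view len own nth_append Let_def)
    qed
  qed
  ultimately show ?thesis unfolding computable_def by blast
qed

text \<open>Initially a processor knows the number of the other vertices but not their identifiers.
  The senders of a round of contentless messages reveal them.\<close>

lemma computable_verts:
  assumes "admissible a \<I>"
  shows "computable \<I> (\<lambda>I v. verts I)"
proof -
  have "computable \<I> (\<lambda>I u v. if v \<in> verts I then Some () else None)"
    by (rule computable_exchange_option[OF assms small_unit computable_const]) simp
  from computable_map[OF this, of "\<lambda>f. {v. f v \<noteq> None}"]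
  show ?thesis by (rule computable_cong) auto
qed

lemma computable_exchange:
  assumes "admissible a \<I>" "small S" "computable \<I> F"
    and "\<And>I v u. I \<in> \<I> \<Longrightarrow> v \<in> verts I \<Longrightarrow> u \<in> verts I \<Longrightarrow> F I v u \<in> S (card (verts I))"
  shows "computable \<I> (\<lambda>I u. \<lambda>v\<in>verts I. F I v u)"
  using computable_map2[OF computable_verts[OF assms(1)] computable_exchange_option[OF assms],
      of "\<lambda>V f. \<lambda>v\<in>V. the (f v)"]
  by (rule computable_cong) (auto simp: restrict_def)

lemma computable_broadcast:
  assumes "admissible a \<I>" "small S" "computable \<I> F"
    and "\<And>I v. I \<in> \<I> \<Longrightarrow> v \<in> verts I \<Longrightarrow> F I v \<in> S (card (verts I))"
  shows "computable \<I> (\<lambda>I u. \<lambda>v\<in>verts I. F I v)"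
  using computable_exchange[OF assms(1,2) computable_map[OF assms(3), of "\<lambda>x u. x"]] assms(4)
  by simp

section \<open>Choosing a good seed and routing\<close>

text \<open>A seed is a word over the alphabet \<open>V\<close>, so that each vertex can take charge
  of one candidate for the next letter.\<close>

definition seeds :: "nat set \<Rightarrow> nat \<Rightarrow> nat list set" where
  "seeds V k = {xs. set xs \<subseteq> V \<and> length xs = k}"

lemma finite_seeds: "finite V \<Longrightarrow> finite (seeds V k)"
  unfolding seeds_def by (rule finite_lists_length_eq)

lemma card_seeds: "finite V \<Longrightarrow> card (seeds V k) = card V ^ k"
  unfolding seeds_def by (rule card_lists_length_eq)

lemma seeds_Suc: "seeds V (Suc k) = (\<lambda>(v, ys). v # ys) ` (V \<times> seeds V k)"
  by (auto simp: seeds_def image_def length_Suc_conv)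

lemma sum_seeds_Suc:
  "(\<Sum>ys\<in>seeds V (Suc k). f ys) = (\<Sum>v\<in>V. \<Sum>ys\<in>seeds V k. f (v # ys))"
proof -
  have "inj_on (\<lambda>(v, ys). v # ys) (V \<times> seeds V k)" by (auto simp: inj_on_def)
  then show ?thesis
    by (simp add: seeds_Suc sum.reindex sum.cartesian_product case_prod_beta')
qed

text \<open>
  The method of conditional expectations, with vertex \<open>u\<close> evaluating the extension by \<open>u\<close> of the
  prefix that has been agreed on so far.
\<close>

lemma computable_seed_prefix:
  fixes bad :: "input \<Rightarrow> nat \<Rightarrow> nat list \<Rightarrow> bool"
  assumes adm: "admissible a \<I>" and bad: "computable \<I> bad" and "k \<le> c"
  defines "T \<equiv> \<lambda>I xs m. \<Sum>ys\<in>seeds (verts I) m. \<Sum>v\<in>verts I. of_bool (bad I v (xs @ ys)) :: nat"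
  shows "\<exists>p. computable \<I> (\<lambda>I v. p I) \<and>
    (\<forall>I\<in>\<I>. p I \<in> seeds (verts I) k \<and> T I (p I) (c - k) * card (verts I) ^ k \<le> T I [] c)"
  using \<open>k \<le> c\<close>
proof (induction k)
  case 0
  show ?case by (rule exI[of _ "\<lambda>_. []"]) (auto simp: seeds_def intro: computable_const)
next
  case (Suc k)
  then obtain p where p: "computable \<I> (\<lambda>I v. p I)"
    "\<And>I. I \<in> \<I> \<Longrightarrow> p I \<in> seeds (verts I) k"
    "\<And>I. I \<in> \<I> \<Longrightarrow> T I (p I) (c - k) * card (verts I) ^ k \<le> T I [] c"
    by auto
  define m where "m = c - Suc k"
  have m: "c - k = Suc m" "m \<le> c" using Suc.prems by (auto simp: m_def)
  \<comment> \<open>For every u, vertex v counts the completions of the prefix extended by u at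
    which it fails, and sends the count to u; u adds the counts up to \<open>t I u\<close>. All
    these numbers are at most n^(c + 1), so they fit into messages.\<close>
  define f where "f I v u = (\<Sum>ys\<in>seeds (verts I) m. of_bool (bad I v (p I @ [u] @ ys)) :: nat)" for I v u
  define t where "t I u = (\<Sum>v\<in>verts I. f I v u)" for I u
  \<comment> \<open>After a broadcast everyone knows \<open>t I\<close>, and the choice operator
    depends on nothing else, so all vertices pick the same letter.\<close>
  define b where "b I = (SOME u. u \<in> verts I \<and> (\<forall>w\<in>verts I. t I u \<le> t I w))" for I
  have f_le: "f I v u \<le> card (verts I) ^ c" if "I \<in> \<I>" for I v u
  proof -
    have "f I v u \<le> (\<Sum>ys\<in>seeds (verts I) m. 1)" unfolding f_def by (rule sum_mono) simp
    also have "\<dots> = card (verts I) ^ m" using admissibleD[OF adm that] by (simp add: card_seeds)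
    also have "\<dots> \<le> card (verts I) ^ c"
      using admissibleD[OF adm that] m by (intro power_increasing) auto
    finally show ?thesis .
  qed
  have t_le: "t I u \<le> card (verts I) ^ Suc c" if "I \<in> \<I>" for I u
    using sum_mono[of "verts I" "\<lambda>v. f I v u" "\<lambda>_. card (verts I) ^ c"] f_le[OF that]
    by (simp add: t_def)
  have "computable \<I> f"
    using computable_map3[OF bad p(1) computable_verts[OF adm],
        of "\<lambda>b p V u. \<Sum>ys\<in>seeds V m. of_bool (b (p @ [u] @ ys))"]
    by (simp add: f_def[abs_def])
  from computable_exchange[OF adm small_poly[of 1 c] this] f_le
  have "computable \<I> (\<lambda>I u. \<lambda>v\<in>verts I. f I v u)" by simp
  from computable_map2[OF this computable_verts[OF adm], of "\<lambda>f V. \<Sum>v\<in>V. f v"]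
  have "computable \<I> t" by (rule computable_cong) (simp add: t_def)
  from computable_broadcast[OF adm small_poly[of 1 "Suc c"] this] t_le
  have "computable \<I> (\<lambda>I u. \<lambda>v\<in>verts I. t I v)" by simp
  from computable_map2[OF this computable_verts[OF adm],
      of "\<lambda>f V. SOME u. u \<in> V \<and> (\<forall>w\<in>V. f u \<le> f w)"]
  have "computable \<I> (\<lambda>I v. b I)"
    by (rule computable_cong) (simp add: b_def cong: conj_cong)
  from computable_map2[OF p(1) this, of "\<lambda>p b. p @ [b]"]
  have 1: "computable \<I> (\<lambda>I v. p I @ [b I])" .
  have "p I @ [b I] \<in> seeds (verts I) (Suc k) \<and>
      T I (p I @ [b I]) (c - Suc k) * card (verts I) ^ Suc k \<le> T I [] c" if I: "I \<in> \<I>" for I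
  proof -
    let ?V = "verts I"
    note V = admissibleD[OF adm I]
    have "\<exists>u. u \<in> ?V \<and> (\<forall>w\<in>?V. t I u \<le> t I w)"
      using V by (metis arg_min_if_finite(1) arg_min_least)
    from someI_ex[OF this] have b: "b I \<in> ?V" "\<And>w. w \<in> ?V \<Longrightarrow> t I (b I) \<le> t I w"
      unfolding b_def by auto
    have tT: "t I u = T I (p I @ [u]) m" for u
      unfolding t_def f_def T_def by (subst sum.swap) simp
    have "T I (p I) (c - k) = (\<Sum>u\<in>?V. t I u)"
      unfolding tT by (simp add: T_def m sum_seeds_Suc)
    \<comment> \<open>The least cost is at most the average over all letters, which yields the next
      factor of \<open>card ?V ^ Suc k\<close>.\<close>
    also have "\<dots> \<ge> card ?V * t I (b I)"
      using sum_mono[of ?V "\<lambda>_. t I (b I)" "t I"] b by simp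
    finally have "card ?V * t I (b I) * card ?V ^ k \<le> T I (p I) (c - k) * card ?V ^ k"
      by (rule mult_right_mono) simp
    also have "\<dots> \<le> T I [] c" by (rule p(3)[OF I])
    finally show ?thesis using p(2)[OF I] b(1)
      by (auto simp: tT m_def seeds_def algebra_simps)
  qed
  with 1 show ?case by (intro exI[of _ "\<lambda>I. p I @ [b I]"]) blast
qed

text \<open>The failures of the chosen seed are at most the average over all seeds; the inequality
  is multiplied out by the number of seeds to stay within the natural numbers.\<close>

lemma computable_good_seed:
  fixes bad :: "input \<Rightarrow> nat \<Rightarrow> nat list \<Rightarrow> bool"
  assumes adm: "admissible a \<I>" and bad: "computable \<I> bad"
  shows "\<exists>p. computable \<I> (\<lambda>I v. p I) \<and>
    (\<forall>I\<in>\<I>. p I \<in> seeds (verts I) c \<and> card {v \<in> verts I. bad I v (p I)} * card (verts I) ^ c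
       \<le> (\<Sum>v\<in>verts I. card {s \<in> seeds (verts I) c. bad I v s}))"
proof -
  obtain p where p: "computable \<I> (\<lambda>I v. p I)"
    "\<And>I. I \<in> \<I> \<Longrightarrow> p I \<in> seeds (verts I) c"
    "\<And>I. I \<in> \<I> \<Longrightarrow> (\<Sum>ys\<in>seeds (verts I) 0. \<Sum>v\<in>verts I. of_bool (bad I v (p I @ ys)) :: nat)
        * card (verts I) ^ c \<le> (\<Sum>ys\<in>seeds (verts I) c. \<Sum>v\<in>verts I. of_bool (bad I v ys))"
    using computable_seed_prefix[OF adm bad order_refl[of c]] by auto
  have "card {v \<in> verts I. bad I v (p I)} * card (verts I) ^ c
       \<le> (\<Sum>v\<in>verts I. card {s \<in> seeds (verts I) c. bad I v s})" if I: "I \<in> \<I>" for I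
  proof -
    note V = admissibleD[OF adm I]
    have "seeds (verts I) 0 = {[]}" by (auto simp: seeds_def)
    then have "card {v \<in> verts I. bad I v (p I)} * card (verts I) ^ c
       \<le> (\<Sum>ys\<in>seeds (verts I) c. \<Sum>v\<in>verts I. of_bool (bad I v ys))"
      using p(3)[OF I] V by (simp add: Int_def)
    also have "\<dots> = (\<Sum>v\<in>verts I. \<Sum>ys\<in>seeds (verts I) c. of_bool (bad I v ys))" by (rule sum.swap)
    finally show ?thesis using V by (simp add: finite_seeds Int_def)
  qed
  with p show ?thesis by blast
qed

section \<open>Balanced routing through relays\<close>

lemma ex_bounded_fibres:
  assumes "finite Z" "finite V" "card Z \<le> c * card V"
  shows "\<exists>\<rho>. (\<forall>z\<in>Z. \<rho> z \<in> V) \<and> (\<forall>y\<in>V. card {z \<in> Z. \<rho> z = y} \<le> c)"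
proof (cases "V = {}")
  case True
  then show ?thesis using assms by auto
next
  case False
  define n where "n = card V"
  have n: "0 < n" using False assms by (simp add: n_def card_gt_0_iff)
  \<comment> \<open>Round robin: number the elements of Z and reduce modulo n. On a fibre the
    quotient by n is injective and below c.\<close>
  obtain f where f: "bij_betw f Z {0..<card Z}" using ex_bij_betw_finite_nat[OF assms(1)] by blast
  obtain e where e: "bij_betw e {0..<n} V"
    using ex_bij_betw_nat_finite[OF assms(2)] n_def by blast
  have "card {z \<in> Z. e (f z mod n) = y} \<le> c" if "y \<in> V" for y
  proof -
    obtain i where i: "i < n" "y = e i" using e \<open>y \<in> V\<close> by (auto simp: bij_betw_def image_iff)
    have "inj_on (\<lambda>z. f z div n) {z \<in> Z. e (f z mod n) = y}"
    proof (rule inj_onI)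
      fix z w assume *: "z \<in> {z \<in> Z. e (f z mod n) = y}" "w \<in> {z \<in> Z. e (f z mod n) = y}"
        "f z div n = f w div n"
      then have "e (f z mod n) = e (f w mod n)" by simp
      then have "f z mod n = f w mod n"
        using e n by (auto simp: bij_betw_def dest!: inj_onD)
      with *(3) have "f z = f w" by (metis div_mult_mod_eq)
      then show "z = w" using f * by (auto simp: bij_betw_def dest: inj_onD)
    qed
    moreover have "(\<lambda>z. f z div n) ` {z \<in> Z. e (f z mod n) = y} \<subseteq> {..<c}"
    proof (rule image_subsetI)
      fix z assume "z \<in> {z \<in> Z. e (f z mod n) = y}"
      then have "f z < card Z" using f by (auto simp: bij_betw_def)
      then have "f z < c * n" using assms(3) n_def by simp
      then show "f z div n \<in> {..<c}" by (simp add: less_mult_imp_div_less)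
    qed
    ultimately show ?thesis by (metis card_inj_on_le card_lessThan finite_lessThan)
  qed
  moreover have "e (f z mod n) \<in> V" for z using e n by (auto simp: bij_betw_def)
  ultimately show ?thesis by (intro exI[of _ "\<lambda>z. e (f z mod n)"]) auto
qed

text \<open>
  The items bound for a destination are numbered by pairs of a vertex and an index below the size
  of its item set. These numbers depend only on public data, so that all vertices agree on an
  assignment of relays under which no relay holds more than \<open>c\<close> items for any one destination.
\<close>

lemma computable_gather:
  fixes A :: "input \<Rightarrow> nat \<Rightarrow> nat set"
  assumes adm: "admissible a \<I>" and dest: "computable \<I> dest" and A: "computable \<I> A"
    and mem: "\<And>I v. I \<in> \<I> \<Longrightarrow> v \<in> verts I \<Longrightarrow> dest I v \<in> verts I"
    and words: "\<And>I v. I \<in> \<I> \<Longrightarrow> v \<in> verts I \<Longrightarrow> A I v \<subseteq> {..<2 ^ (w * log_bits (card (verts I)))}"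
    and load: "\<And>I u. I \<in> \<I> \<Longrightarrow> u \<in> verts I \<Longrightarrow>
      (\<Sum>v | v \<in> verts I \<and> dest I v = u. card (A I v)) \<le> c * card (verts I)"
  shows "computable \<I> (\<lambda>I u. {(v, x). v \<in> verts I \<and> dest I v = u \<and> x \<in> A I v})"
proof -
  define tags where "tags V dl u = {(v, k). v \<in> V \<and> fst (dl v) = u \<and> k < snd (dl v)}"
    for V u and dl :: "nat \<Rightarrow> nat \<times> nat"
  define \<rho> where "\<rho> V dl u = (SOME \<rho>. (\<forall>z\<in>tags V dl u. \<rho> z \<in> V) \<and>
      (\<forall>y\<in>V. card {z \<in> tags V dl u. \<rho> z = y} \<le> c))" for V u and dl :: "nat \<Rightarrow> nat \<times> nat"
  define item where "item B = (SOME f. bij_betw f {0..<card B} B)" for B :: "nat set"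
  define dl where "dl I = (\<lambda>v\<in>verts I. (dest I v, card (A I v)))" for I
  \<comment> \<open>\<open>m1 I v y\<close> is what v hands to relay y, and \<open>m2 I y u\<close>
    is what y passes on to u; two rounds suffice once the sizes are public.\<close>
  define m1 where "m1 I v y = {item (A I v) k |k. k < card (A I v) \<and>
      \<rho> (verts I) (dl I) (dest I v) (v, k) = y}" for I v y
  define m2 where "m2 I y u = {(v, x). v \<in> verts I \<and> dest I v = u \<and> x \<in> m1 I v y}" for I y u
  have fin: "finite (A I v)" if "I \<in> \<I>" "v \<in> verts I" for I v
    using words[OF that] finite_subset by blast
  have item: "bij_betw (item B) {0..<card B} B" if "finite B" for B
    unfolding item_def by (rule someI_ex[OF ex_bij_betw_nat_finite[OF that]])
  have A_le: "card (A I v) \<le> c * card (verts I)" if "I \<in> \<I>" "v \<in> verts I" for I v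
  proof -
    have "card (A I v) \<le> (\<Sum>w | w \<in> verts I \<and> dest I w = dest I v. card (A I w))"
      using that admissibleD[OF adm that(1)] by (intro member_le_sum) auto
    also have "\<dots> \<le> c * card (verts I)" by (rule load[OF that(1) mem[OF that]])
    finally show ?thesis .
  qed
  have tags: "tags (verts I) (dl I) u = (SIGMA v:{v \<in> verts I. dest I v = u}. {..<card (A I v)})"
    for I u by (auto simp: tags_def dl_def)
  have card_tags: "finite (tags (verts I) (dl I) u)" "card (tags (verts I) (dl I) u) \<le> c * card (verts I)"
    if "I \<in> \<I>" "u \<in> verts I" for I u
    using admissibleD[OF adm that(1)] load[OF that] by (auto simp: tags card_SigmaI)
  have \<rho>: "\<And>z. z \<in> tags (verts I) (dl I) u \<Longrightarrow> \<rho> (verts I) (dl I) u z \<in> verts I"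
    "\<And>y. y \<in> verts I \<Longrightarrow> card {z \<in> tags (verts I) (dl I) u. \<rho> (verts I) (dl I) u z = y} \<le> c"
    if "I \<in> \<I>" "u \<in> verts I" for I u
    using someI_ex[OF ex_bounded_fibres[OF card_tags(1)[OF that] admissibleD(1)[OF adm that(1)]
        card_tags(2)[OF that]]] unfolding \<rho>_def[symmetric] by blast+
  have in_tags: "(v, k) \<in> tags (verts I) (dl I) (dest I v)"
    if "v \<in> verts I" "k < card (A I v)" for I v k using that by (simp add: tags_def dl_def)
  have m2_image: "m2 I y u = (\<lambda>(v, k). (v, item (A I v) k)) `
      {z \<in> tags (verts I) (dl I) u. \<rho> (verts I) (dl I) u z = y}" for I y u
    by (force simp: m2_def m1_def tags_def dl_def image_iff)
  have card_m2: "card (m2 I y u) \<le> c" if "I \<in> \<I>" "y \<in> verts I" "u \<in> verts I" for I y u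
    unfolding m2_image
    by (rule le_trans[OF card_image_le \<rho>(2)[OF that(1,3,2)]])
      (rule finite_subset[OF _ card_tags(1)[OF that(1,3)]], auto)
  have m1_sub: "m1 I v y \<subseteq> A I v" if "I \<in> \<I>" "v \<in> verts I" for I v y
    using item[OF fin[OF that]] by (auto simp: m1_def bij_betw_def)
  \<comment> \<open>All items of v have the same destination, so the bound on what y holds for that
    destination also bounds what v sends to y.\<close>
  have card_m1: "card (m1 I v y) \<le> c" if "I \<in> \<I>" "v \<in> verts I" "y \<in> verts I" for I v y
  proof -
    have "m1 I v y \<subseteq> snd ` m2 I y (dest I v)" using that by (force simp: m2_def)
    moreover have "finite (m2 I y (dest I v))" unfolding m2_image
      by (rule finite_imageI) (rule finite_subset[OF _ card_tags(1)[OF that(1) mem[OF that(1,2)]]], auto)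
    ultimately have "card (m1 I v y) \<le> card (m2 I y (dest I v))" by (meson surj_card_le)
    then show ?thesis using card_m2[OF that(1,3) mem[OF that(1,2)]] by simp
  qed
  have \<open>computable \<I> (\<lambda>I u. \<lambda>v\<in>verts I. (dest I v, card (A I v)))\<close>
  proof (rule computable_broadcast[OF adm])
    show "small (\<lambda>n. {..<2 ^ (a * log_bits n) :: nat} \<times> {..c * n ^ 1})"
      by (intro small_Times small_words small_poly)
    show "computable \<I> (\<lambda>I v. (dest I v, card (A I v)))"
      by (intro computable_pair dest computable_map[OF A, of card])
    show "(dest I v, card (A I v)) \<in> {..<2 ^ (a * log_bits (card (verts I)))} \<times>
        {..c * card (verts I) ^ 1}" if "I \<in> \<I>" "v \<in> verts I" for I v
      using subsetD[OF admissibleD(4)[OF adm that(1)] mem[OF that]] A_le[OF that] by simp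
  qed
  then have dl: "computable \<I> (\<lambda>I v. dl I)" by (simp add: dl_def)
  have "computable \<I> m1"
    using computable_map4[OF computable_verts[OF adm] dl computable_pair[OF dest computable_id] A,
        of "\<lambda>V dl (d, v) B y. {item B k |k. k < card B \<and> \<rho> V dl d (v, k) = y}"]
    by (simp add: m1_def[abs_def])
  then have m1: "computable \<I> (\<lambda>I y. \<lambda>v\<in>verts I. m1 I v y)"
    by (rule computable_exchange[OF adm small_subsets[OF small_words[of w], of c]])
      (use m1_sub words card_m1 in blast)
  from computable_map3[OF computable_verts[OF adm] dl m1,
      of "\<lambda>V dl m u. {(v, x). v \<in> V \<and> fst (dl v) = u \<and> x \<in> m v}"]
  have "computable \<I> m2"
    by (rule computable_cong) (auto simp: m2_def dl_def fun_eq_iff)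
  then have m2: "computable \<I> (\<lambda>I u. \<lambda>y\<in>verts I. m2 I y u)"
  proof (rule computable_exchange[OF adm small_subsets[OF small_Times[OF small_words[of a] small_words[of w]], of c]])
    fix I v u assume *: "I \<in> \<I>" "v \<in> verts I" "u \<in> verts I"
    have "m2 I v u \<subseteq> verts I \<times> {..<2 ^ (w * log_bits (card (verts I)))}"
      using m1_sub[OF *(1)] words[OF *(1)] by (force simp: m2_def)
    then show "m2 I v u \<in> {X. X \<subseteq> {..<2 ^ (a * log_bits (card (verts I)))} \<times>
          {..<2 ^ (w * log_bits (card (verts I)))} \<and> card X \<le> c}"
      using admissibleD(4)[OF adm *(1)] card_m2[OF *] by blast
  qed
  from computable_map2[OF computable_verts[OF adm] m2, of "\<lambda>V m. \<Union>y\<in>V. m y"]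
  show ?thesis
  proof (rule computable_cong)
    fix I u assume *: "I \<in> \<I>" "u \<in> verts I"
    have "\<exists>y\<in>verts I. x \<in> m1 I v y" if v: "v \<in> verts I" "x \<in> A I v" for v x
    proof -
      obtain k where k: "k < card (A I v)" "x = item (A I v) k"
        using bij_betw_imp_surj_on[OF item[OF fin[OF *(1) v(1)]]] v(2)
        by (metis atLeastLessThan_iff image_iff)
      then show ?thesis using \<rho>(1)[OF *(1) mem[OF *(1) v(1)] in_tags[OF v(1) k(1)]]
        by (auto simp: m1_def)
    qed
    then show "(\<Union>y\<in>verts I. (\<lambda>y\<in>verts I. m2 I y u) y) =
        {(v, x). v \<in> verts I \<and> dest I v = u \<and> x \<in> A I v}"
      using m1_sub[OF *(1)] by (fastforce simp: m2_def)
  qed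
qed

section \<open>Colouring bins in parallel\<close>

lemma greedy_list_colouring:
  assumes "finite U" and sym: "\<And>u v. v \<in> N u \<Longrightarrow> u \<in> N v" and irrefl: "\<And>u. u \<notin> N u"
    and "\<And>v. v \<in> U \<Longrightarrow> finite (L v) \<and> card (N v \<inter> U) < card (L v)"
  shows "\<exists>f. \<forall>v\<in>U. f v \<in> L v \<and> (\<forall>w\<in>N v \<inter> U. f w \<noteq> f v)"
  using assms(1,4)
proof (induction U)
  case (insert u U)
  have mono: "card (N v \<inter> U) \<le> card (N v \<inter> insert u U)" for v
    using insert.hyps(1) by (intro card_mono) auto
  then have "card (N v \<inter> U) < card (L v)" if "v \<in> U" for v
    using insert.prems[of v] that le_less_trans by blast
  then obtain f where f: "\<forall>v\<in>U. f v \<in> L v \<and> (\<forall>w\<in>N v \<inter> U. f w \<noteq> f v)"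
    using insert.IH insert.prems by auto
  have "card (f ` (N u \<inter> U)) \<le> card (N u \<inter> U)" using insert.hyps by (intro card_image_le) auto
  also have "\<dots> < card (L u)"
    using insert.prems[of u] mono[of u] by simp
  finally have "\<not> L u \<subseteq> f ` (N u \<inter> U)"
    using insert.hyps card_mono[of "f ` (N u \<inter> U)" "L u"] by auto
  then obtain x where x: "x \<in> L u" "x \<notin> f ` (N u \<inter> U)" by blast
  show ?case
    by (rule exI[of _ "f(u := x)"]) (use f x irrefl sym insert.hyps in auto)
qed auto

definition max_deg :: "input \<Rightarrow> nat" where
  "max_deg I = max_degree (fst I) (fst (snd I))"

definition partial_proper :: "input \<Rightarrow> (nat \<Rightarrow> nat option) \<Rightarrow> bool" where
  "partial_proper I c \<longleftrightarrow> (\<forall>v x. c v = Some x \<longrightarrow> v \<in> verts I \<and> x \<in> pal I v) \<and>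
     (\<forall>v. \<forall>w\<in>nbhd I v. c v \<noteq> None \<longrightarrow> c w \<noteq> c v)"

definition residual :: "input \<Rightarrow> (nat \<Rightarrow> nat option) \<Rightarrow> nat \<Rightarrow> nat set" where
  "residual I c v = {x \<in> pal I v. \<forall>w\<in>nbhd I v. c w \<noteq> Some x}"

definition binmates :: "input \<Rightarrow> (nat \<Rightarrow> nat option) \<Rightarrow> nat \<Rightarrow> nat set" where
  "binmates I bin v = {w \<in> nbhd I v. bin w = bin v}"

locale colouring_inputs =
  fixes \<I> :: "input set" and a b :: nat
  assumes input: "I \<in> \<I> \<Longrightarrow> list_colouring_input a b (fst I) (fst (snd I)) (snd (snd I))"
begin

lemma adm: "admissible a \<I>"
  using input by (auto simp: admissible_def list_colouring_input_def simple_graph_def verts_def)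

lemmas adm_simps = admissibleD[OF adm]

lemma nbhd_props:
  assumes "I \<in> \<I>"
  shows "nbhd I v \<subseteq> verts I" "finite (nbhd I v)" "v \<notin> nbhd I v" "w \<in> nbhd I v \<Longrightarrow> v \<in> nbhd I w"
proof -
  have E: "\<And>e. e \<in> fst (snd I) \<Longrightarrow> e \<subseteq> verts I \<and> card e = 2"
    using input[OF assms] by (auto simp: list_colouring_input_def simple_graph_def verts_def)
  show sub: "nbhd I v \<subseteq> verts I" using E by (auto simp: nbhd_def neighbours_def)
  show "finite (nbhd I v)" using finite_subset[OF sub] adm_simps(1)[OF assms] .
  show "v \<notin> nbhd I v" using E[of "{v}"] by (auto simp: nbhd_def neighbours_def)
  show "v \<in> nbhd I w" if "w \<in> nbhd I v"
    using that by (auto simp: nbhd_def neighbours_def insert_commute)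
qed

lemma pal_props:
  assumes "I \<in> \<I>" "v \<in> verts I"
  shows "card (pal I v) = max_deg I + 1" "pal I v \<subseteq> {..<2 ^ (b * log_bits (card (verts I)))}"
    "finite (pal I v)"
proof -
  show "card (pal I v) = max_deg I + 1" "pal I v \<subseteq> {..<2 ^ (b * log_bits (card (verts I)))}"
    using assms input[OF assms(1)]
    by (auto simp: list_colouring_input_def verts_def pal_def max_deg_def)
  then show "finite (pal I v)" using finite_subset by blast
qed

lemma card_nbhd_le: 
  assumes "I \<in> \<I>" "v \<in> verts I"
  shows "card (nbhd I v) \<le> max_deg I"
  using assms adm_simps(1)[OF assms(1)] unfolding max_deg_def max_degree_def nbhd_def verts_def
  by (intro Max_ge) auto

lemma max_deg_less:
  assumes "I \<in> \<I>"
  shows "max_deg I < card (verts I)"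
proof -
  have "card (nbhd I v) < card (verts I)" if "v \<in> verts I" for v
    using nbhd_props[OF assms, of v] adm_simps(1)[OF assms] that by (intro psubset_card_mono) auto
  then show ?thesis using adm_simps(1,2)[OF assms]
    by (simp add: max_deg_def max_degree_def nbhd_def verts_def)
qed

text \<open>Palettes have size \<open>max_deg I + 1\<close>, so a vertex reads off the maximum
  degree without communication.\<close>

lemma computable_max_deg: "computable \<I> (\<lambda>I v. max_deg I)"
  by (rule computable_cong[OF computable_map[OF computable_pal, where h = "\<lambda>P. card P - 1"]])
    (simp add: pal_props)

lemma residual_subset: "residual I c v \<subseteq> pal I v"
  by (auto simp: residual_def)

text \<open>Bin i is sent to the i-th vertex, which colours it greedily and returns the colours. A
  vertex submits only one colour more than it has binmates: this is enough for the greedy argument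
  and makes the traffic proportional to the degree inside the bin instead of the palette
  size.\<close>

lemma computable_bin_colouring:
  assumes bin: "computable \<I> (\<lambda>I v. bin I)" and Q: "computable \<I> Q"
    and active: "\<And>I v i. I \<in> \<I> \<Longrightarrow> bin I v = Some i \<Longrightarrow> v \<in> verts I \<and> i < card (verts I) \<and>
      Q I v \<subseteq> pal I v \<and> card (binmates I (bin I) v) < card (Q I v)"
    and load: "\<And>I i. I \<in> \<I> \<Longrightarrow>
      (\<Sum>v | bin I v = Some i. 2 * card (binmates I (bin I) v) + 1) \<le> k * card (verts I)"
  shows "\<exists>f. computable \<I> (\<lambda>I v. f I) \<and> (\<forall>I\<in>\<I>. \<forall>v. bin I v \<noteq> None \<longrightarrow>
    f I v \<in> Q I v \<and> (\<forall>w\<in>binmates I (bin I) v. f I w \<noteq> f I v))"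
proof -
  define trim where "trim Q k = (SOME Y. Y \<subseteq> Q \<and> card Y = k)" for Q :: "nat set" and k
  define L where "L I v = trim (Q I v) (Suc (card (binmates I (bin I) v)))" for I v
  \<comment> \<open>neighbours are sent as even and colours as odd numbers\<close>
  define A where "A I v = (if bin I v = None then {} else
      (\<lambda>w. 2 * w) ` binmates I (bin I) v \<union> (\<lambda>x. 2 * x + 1) ` L I v)" for I v
  define e where "e V = (SOME e. bij_betw e {0..<card V} V)" for V :: "nat set"
  define dest where "dest I v = (case bin I v of None \<Rightarrow> v | Some i \<Rightarrow> e (verts I) i)" for I v
  define Z where "Z I u = {(v, x). v \<in> verts I \<and> dest I v = u \<and> x \<in> A I v}" for I u
  define valid where "valid Z f \<longleftrightarrow> (\<forall>v\<in>fst ` Z. (v, 2 * f v + 1) \<in> Z \<and>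
      (\<forall>w. (v, 2 * w) \<in> Z \<longrightarrow> f w \<noteq> f v))" for Z :: "(nat \<times> nat) set" and f
  define sol where "sol Z = (SOME f. valid Z f)" for Z
  \<comment> \<open>The 0 is a filler, as an exchange requires a message in range for every pair of
    vertices.\<close>
  define reply where "reply I u v = (if v \<in> fst ` Z I u then sol (Z I u) v else 0)" for I u v
  define f where "f I = (\<lambda>v\<in>verts I. reply I (dest I v) v)" for I
  have e: "bij_betw (e (verts I)) {0..<card (verts I)} (verts I)" if "I \<in> \<I>" for I
    unfolding e_def by (rule someI_ex[OF ex_bij_betw_nat_finite[OF adm_simps(1)[OF that]]])
  have fin_bm: "finite (binmates I (bin I) v)" if "I \<in> \<I>" for I v
    using nbhd_props(2)[OF that] by (simp add: binmates_def)
  have L: "L I v \<subseteq> Q I v" "card (L I v) = Suc (card (binmates I (bin I) v))" "finite (L I v)"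
    if I: "I \<in> \<I>" and v: "bin I v \<noteq> None" for I v
  proof -
    have "Suc (card (binmates I (bin I) v)) \<le> card (Q I v)" using active[OF I, of v] v by auto
    from obtain_subset_with_card_n[OF this]
    have "\<exists>Y. Y \<subseteq> Q I v \<and> card Y = Suc (card (binmates I (bin I) v))" by metis
    from someI_ex[OF this] show "L I v \<subseteq> Q I v" "card (L I v) = Suc (card (binmates I (bin I) v))"
      unfolding L_def trim_def by auto
    then show "finite (L I v)" using card.infinite by fastforce
  qed
  have dest_in: "dest I v \<in> verts I" if "I \<in> \<I>" "v \<in> verts I" for I v
    using e[OF that(1)] active[OF that(1), of v] that
    by (auto simp: dest_def bij_betw_def split: option.split)
  have in_A: "2 * w \<in> A I v \<longleftrightarrow> bin I v \<noteq> None \<and> w \<in> binmates I (bin I) v"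
    "2 * x + 1 \<in> A I v \<longleftrightarrow> bin I v \<noteq> None \<and> x \<in> L I v" for I v w x
  proof -
    show "2 * w \<in> A I v \<longleftrightarrow> bin I v \<noteq> None \<and> w \<in> binmates I (bin I) v"
      unfolding A_def by auto presburger
    show "2 * x + 1 \<in> A I v \<longleftrightarrow> bin I v \<noteq> None \<and> x \<in> L I v"
      unfolding A_def by auto presburger
  qed
  have card_A: "card (A I v) = (if bin I v = None then 0 else 2 * card (binmates I (bin I) v) + 1)"
    if I: "I \<in> \<I>" for I v
  proof (cases "bin I v = None")
    case False
    have "card (A I v) = card ((\<lambda>w. 2 * w) ` binmates I (bin I) v) + card ((\<lambda>x. 2 * x + 1) ` L I v)"
      unfolding A_def using False fin_bm[OF I] L[OF I False]
      by (simp, subst card_Un_disjoint) (auto, presburger)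
    also have "\<dots> = card (binmates I (bin I) v) + card (L I v)"
      by (simp add: card_image inj_on_def)
    finally show ?thesis using False L[OF I False] by simp
  qed (simp add: A_def)
  \<comment> \<open>The summand 1 pays for the bit that distinguishes neighbours from
    colours.\<close>
  have words: "A I v \<subseteq> {..<2 ^ ((a + b + 1) * log_bits (card (verts I)))}"
    if I: "I \<in> \<I>" and v: "v \<in> verts I" for I v
  proof -
    let ?l = "log_bits (card (verts I))"
    have l: "1 \<le> ?l" using log_bits_pos[of "card (verts I)"] adm_simps(3)[OF I] by simp
    have "2 * 2 ^ (a * ?l) \<le> (2::nat) ^ ((a + b + 1) * ?l)" "2 * 2 ^ (b * ?l) \<le> (2::nat) ^ ((a + b + 1) * ?l)"
      using l by (auto simp flip: power_Suc intro!: power_increasing simp: algebra_simps)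
    moreover have "w < 2 ^ (a * ?l)" if "w \<in> binmates I (bin I) v" for w
      using that nbhd_props(1)[OF I] adm_simps(4)[OF I] by (auto simp: binmates_def)
    moreover have "x < 2 ^ (b * ?l)" if "x \<in> L I v" "bin I v \<noteq> None" for x
      using that L(1)[OF I that(2)] active[OF I, of v] pal_props(2)[OF I v] by auto
    ultimately show ?thesis by (fastforce simp: A_def split: if_splits)
  qed
  \<comment> \<open>An inactive vertex is its own destination and may thereby coincide with the
    collector of a bin, but its item set is empty; hence the condition on
    \<open>bin I v\<close>.\<close>
  have dest_bin: "{v \<in> verts I. dest I v = e (verts I) i \<and> bin I v \<noteq> None} = {v. bin I v = Some i}"
    if I: "I \<in> \<I>" and i: "i < card (verts I)" for I i
  proof -
    have "e (verts I) j = e (verts I) i \<longleftrightarrow> j = i" if "j < card (verts I)" for j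
      using e[OF I] that i by (auto simp: bij_betw_def dest: inj_onD)
    then show ?thesis using active[OF I] by (fastforce simp: dest_def split: option.splits)
  qed
  have load': "(\<Sum>v | v \<in> verts I \<and> dest I v = u. card (A I v)) \<le> k * card (verts I)"
    if I: "I \<in> \<I>" and u: "u \<in> verts I" for I u
  proof -
    obtain i where i: "i < card (verts I)" "u = e (verts I) i"
      using e[OF I] u unfolding bij_betw_def by (metis atLeastLessThan_iff image_iff)
    have "(\<Sum>v | v \<in> verts I \<and> dest I v = u. card (A I v)) =
        (\<Sum>v\<in>{v \<in> verts I. dest I v = u \<and> bin I v \<noteq> None}. card (A I v))"
      using adm_simps(1)[OF I] by (intro sum.mono_neutral_right) (auto simp: card_A[OF I])
    also have "\<dots> = (\<Sum>v | bin I v = Some i. 2 * card (binmates I (bin I) v) + 1)"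
      unfolding i(2) dest_bin[OF I i(1)] by (intro sum.cong) (auto simp: card_A[OF I])
    finally show ?thesis using load[OF I, of i] by simp
  qed
  have fst_Z: "fst ` Z I u = {v \<in> verts I. dest I v = u \<and> bin I v \<noteq> None}" if I: "I \<in> \<I>" for I u
  proof -
    have "A I v \<noteq> {} \<longleftrightarrow> bin I v \<noteq> None" for v
      using card_A[OF I, of v] by (auto simp: A_def)
    then show ?thesis by (force simp: Z_def image_iff)
  qed
  have valid: "valid (Z I u) (sol (Z I u))" if I: "I \<in> \<I>" and u: "u \<in> verts I" for I u
  proof -
    obtain i where i: "i < card (verts I)" "u = e (verts I) i"
      using e[OF I] u unfolding bij_betw_def by (metis atLeastLessThan_iff image_iff)
    let ?U = "{v. bin I v = Some i}"
    have "\<exists>f. \<forall>v\<in>?U. f v \<in> L I v \<and> (\<forall>w\<in>nbhd I v \<inter> ?U. f w \<noteq> f v)"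
    proof (rule greedy_list_colouring)
      have "?U \<subseteq> verts I" using active[OF I] by auto
      then show "finite ?U" by (rule finite_subset[OF _ adm_simps(1)[OF I]])
      fix v assume v: "v \<in> ?U"
      then have "nbhd I v \<inter> ?U = binmates I (bin I) v" by (auto simp: binmates_def)
      then show "finite (L I v) \<and> card (nbhd I v \<inter> ?U) < card (L I v)" using L[OF I, of v] v by simp
    qed (use nbhd_props[OF I] in auto)
    then obtain f where f: "\<And>v. v \<in> ?U \<Longrightarrow> f v \<in> L I v"
      "\<And>v w. v \<in> ?U \<Longrightarrow> w \<in> nbhd I v \<inter> ?U \<Longrightarrow> f w \<noteq> f v" by blast
    have U: "fst ` Z I u = ?U" using fst_Z[OF I] dest_bin[OF I i(1)] i(2) by simp
    have "valid (Z I u) f"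
      unfolding valid_def U
    proof (intro ballI conjI allI impI)
      fix v assume v: "v \<in> ?U"
      have vZ: "v \<in> verts I" "dest I v = u" using v U fst_Z[OF I] by auto
      show "(v, 2 * f v + 1) \<in> Z I u"
        unfolding Z_def using f(1)[OF v] v vZ in_A(2)[of "f v" I v] by simp
      fix w assume "(v, 2 * w) \<in> Z I u"
      then have "w \<in> nbhd I v \<inter> ?U"
        using in_A(1)[of w I v] v by (auto simp: Z_def binmates_def)
      then show "f w \<noteq> f v" using f(2)[OF v] by blast
    qed
    then show ?thesis unfolding sol_def by (rule someI[of "valid (Z I u)"])
  qed
  have f_props: "f I v \<in> L I v" "\<And>w. w \<in> binmates I (bin I) v \<Longrightarrow> f I w \<noteq> f I v"
    if I: "I \<in> \<I>" and v: "bin I v \<noteq> None" for I v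
  proof -
    have vV: "v \<in> verts I" using active[OF I, of v] v by auto
    let ?u = "dest I v"
    have vZ: "v \<in> fst ` Z I ?u" using fst_Z[OF I] vV v by auto
    have fv: "f I v = sol (Z I ?u) v" using vZ vV by (simp add: f_def reply_def)
    have va: "(v, 2 * f I v + 1) \<in> Z I ?u" "\<And>w. (v, 2 * w) \<in> Z I ?u \<Longrightarrow> sol (Z I ?u) w \<noteq> f I v"
      using valid[OF I dest_in[OF I vV]] vZ unfolding valid_def fv by blast+
    show "f I v \<in> L I v" using va(1) in_A(2)[of "f I v" I v] by (simp add: Z_def)
    fix w assume w: "w \<in> binmates I (bin I) v"
    then have w': "bin I w = bin I v" by (simp add: binmates_def)
    have wV: "w \<in> verts I" using active[OF I, of w] v w' by auto
    have du: "dest I w = ?u" using w' v by (auto simp: dest_def)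
    have "f I w = sol (Z I ?u) w"
      using fst_Z[OF I, of ?u] wV du w' v by (simp add: f_def reply_def)
    moreover have "(v, 2 * w) \<in> Z I ?u" unfolding Z_def using w v vV in_A(1)[of w I v] by simp
    ultimately show "f I w \<noteq> f I v" using va(2) by simp
  qed
  have reply_words: "reply I u v < 2 ^ (b * log_bits (card (verts I)))"
    if I: "I \<in> \<I>" and u: "u \<in> verts I" for I u v
  proof (cases "v \<in> fst ` Z I u")
    case True
    then have v: "v \<in> verts I" "dest I v = u" "bin I v \<noteq> None" using fst_Z[OF I] by auto
    have "f I v \<in> pal I v" using f_props(1)[OF I v(3)] L(1)[OF I v(3)] active[OF I, of v] v(3) by auto
    then show ?thesis using pal_props(2)[OF I v(1)] v by (auto simp: f_def)
  qed (simp add: reply_def)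
  note V = computable_verts[OF adm]
  have cL: "computable \<I> L"
    using computable_map4[OF bin Q computable_nbhd computable_id, where
        h = "\<lambda>b Q N v. trim Q (Suc (card {w \<in> N. b w = b v}))"]
    by (simp add: L_def[abs_def] binmates_def)
  have cA: "computable \<I> A"
    using computable_map4[OF bin cL computable_nbhd computable_id, where
        h = "\<lambda>b L N v. if b v = None then {} else
            (\<lambda>w. 2 * w) ` {w \<in> N. b w = b v} \<union> (\<lambda>x. 2 * x + 1) ` L"]
    by (simp add: A_def[abs_def] binmates_def cong: if_cong)
  have cdest: "computable \<I> dest"
    using computable_map3[OF bin V computable_id, where
        h = "\<lambda>b V v. case b v of None \<Rightarrow> v | Some i \<Rightarrow> e V i"]
    by (simp add: dest_def[abs_def])
  have "computable \<I> Z"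
    using computable_gather[OF adm cdest cA dest_in words load'] by (simp add: Z_def[abs_def])
  from computable_map[OF this, where h = "\<lambda>Z v. if v \<in> fst ` Z then sol Z v else 0"]
  have "computable \<I> reply" by (simp add: reply_def[abs_def])
  then have "computable \<I> (\<lambda>I v. \<lambda>u\<in>verts I. reply I u v)"
    by (rule computable_exchange[OF adm small_words[of b]]) (use reply_words in auto)
  from computable_map2[OF this cdest, where h = "\<lambda>r d. r d"]
  have "computable \<I> (\<lambda>I v. reply I (dest I v) v)"
    by (rule computable_cong) (simp add: dest_in)
  then have "computable \<I> (\<lambda>I u. f I)"
    unfolding f_def by (rule computable_broadcast[OF adm small_words[of b]])
      (use reply_words dest_in in auto)
  with f_props L(1) show ?thesis by (intro exI[of _ f]) blast
qed

text \<open>Three kinds of conflict are excluded separately: with vertices coloured before because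
  \<open>Q\<close> lies in the residual palette, inside a bin by its collector, and between bins by
  the disjointness of \<open>Q\<close>.\<close>

lemma computable_extend_colouring:
  assumes c: "computable \<I> (\<lambda>I v. c I)" and bin: "computable \<I> (\<lambda>I v. bin I)"
    and Q: "computable \<I> Q"
    and proper: "\<And>I. I \<in> \<I> \<Longrightarrow> partial_proper I (c I)"
    and active: "\<And>I v i. I \<in> \<I> \<Longrightarrow> bin I v = Some i \<Longrightarrow> v \<in> verts I \<and> i < card (verts I) \<and>
      c I v = None \<and> Q I v \<subseteq> residual I (c I) v \<and> card (binmates I (bin I) v) < card (Q I v)"
    and disjoint: "\<And>I v w i j. I \<in> \<I> \<Longrightarrow> bin I v = Some i \<Longrightarrow> bin I w = Some j \<Longrightarrow> i \<noteq> j \<Longrightarrow>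
      Q I v \<inter> Q I w = {}"
    and load: "\<And>I i. I \<in> \<I> \<Longrightarrow>
      (\<Sum>v | bin I v = Some i. 2 * card (binmates I (bin I) v) + 1) \<le> k * card (verts I)"
  shows "\<exists>c'. computable \<I> (\<lambda>I v. c' I) \<and> (\<forall>I\<in>\<I>. partial_proper I (c' I) \<and>
    (\<forall>v. bin I v = None \<longrightarrow> c' I v = c I v) \<and> (\<forall>v. bin I v \<noteq> None \<longrightarrow> c' I v \<noteq> None))"
proof -
  obtain f where f: "computable \<I> (\<lambda>I v. f I)"
    "\<And>I v. I \<in> \<I> \<Longrightarrow> bin I v \<noteq> None \<Longrightarrow> f I v \<in> Q I v"
    "\<And>I v w. I \<in> \<I> \<Longrightarrow> bin I v \<noteq> None \<Longrightarrow> w \<in> binmates I (bin I) v \<Longrightarrow> f I w \<noteq> f I v"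
  proof -
    have "v \<in> verts I \<and> i < card (verts I) \<and> Q I v \<subseteq> pal I v \<and>
        card (binmates I (bin I) v) < card (Q I v)" if "I \<in> \<I>" "bin I v = Some i" for I v i
      using active[OF that] residual_subset[of I "c I" v] by blast
    from computable_bin_colouring[OF bin Q this load] show ?thesis using that by blast
  qed
  define c' where "c' I v = (if bin I v = None then c I v else Some (f I v))" for I v
  have "computable \<I> (\<lambda>I v. c' I)"
    using computable_map3[OF c bin f(1), where h = "\<lambda>c b f v. if b v = None then c v else Some (f v)"]
    by (simp add: c'_def[abs_def])
  moreover have "partial_proper I (c' I)" if I: "I \<in> \<I>" for I
    unfolding partial_proper_def
  proof (intro conjI allI impI ballI)
    have fres: "f I v \<in> residual I (c I) v" "v \<in> verts I" if "bin I v \<noteq> None" for v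
      using f(2)[OF I that] active[OF I, of v] that by auto
    show "v \<in> verts I" "x \<in> pal I v" if "c' I v = Some x" for v x
      using that proper[OF I] fres[of v] subsetD[OF residual_subset[of I "c I" v]]
      by (auto simp: c'_def partial_proper_def split: if_splits)
    fix v w assume w: "w \<in> nbhd I v" and v: "c' I v \<noteq> None"
    have v': "v \<in> nbhd I w" using nbhd_props(4)[OF I w] .
    show "c' I w \<noteq> c' I v"
    proof (cases "bin I v = None \<or> bin I w = None")
      case True
      have "c I v \<noteq> None \<Longrightarrow> c I w \<noteq> c I v"
        using proper[OF I] w unfolding partial_proper_def by blast
      then show ?thesis using True fres(1)[of v] fres(1)[of w] w v v'
        by (auto simp: c'_def residual_def)
    next
      case False
      show ?thesis
      proof (cases "bin I v = bin I w")
        case True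
        then show ?thesis using False f(3)[OF I, of v w] w by (auto simp: c'_def binmates_def)
      next
        case neq: False
        obtain i j where ij: "bin I v = Some i" "bin I w = Some j" using False by auto
        then have "Q I v \<inter> Q I w = {}" using neq by (intro disjoint[OF I]) auto
        then show ?thesis using ij f(2)[OF I, of v] f(2)[OF I, of w] by (auto simp: c'_def)
      qed
    qed
  qed
  ultimately show ?thesis by (intro exI[of _ c']) (auto simp: c'_def)
qed

end

section \<open>Random functions\<close>

text \<open>The moment generating function of a binomial variable as a counting identity: by
  independence the sum over all functions factors over the arguments. The injection
  \<open>\<phi>\<close> allows vertices and colours to sit at different arguments of one
  function.\<close>

lemma sum_PiE_power_card:
  fixes w :: real
  assumes "finite D" "finite B" "\<phi> ` S \<subseteq> D" "inj_on \<phi> S" "T \<subseteq> B"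
  shows "(\<Sum>h\<in>D \<rightarrow>\<^sub>E B. w ^ card {x \<in> S. h (\<phi> x) \<in> T}) =
    real (card B) ^ (card D - card S) * (card B + (w - 1) * card T) ^ card S"
proof -
  have cS: "card (\<phi> ` S) = card S" by (rule card_image[OF assms(4)])
  have fin: "finite T" "finite (\<phi> ` S)" using assms finite_subset by auto
  have "(\<Sum>h\<in>D \<rightarrow>\<^sub>E B. w ^ card {x \<in> S. h (\<phi> x) \<in> T}) =
      (\<Sum>h\<in>D \<rightarrow>\<^sub>E B. \<Prod>y\<in>D. if y \<in> \<phi> ` S \<and> h y \<in> T then w else 1)"
  proof (rule sum.cong[OF refl])
    fix h
    have "\<phi> ` {x \<in> S. h (\<phi> x) \<in> T} = {y \<in> \<phi> ` S. h y \<in> T}" by auto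
    then have "card {x \<in> S. h (\<phi> x) \<in> T} = card {y \<in> \<phi> ` S. h y \<in> T}"
      using card_image[OF inj_on_subset[OF assms(4)], of "{x \<in> S. h (\<phi> x) \<in> T}"] by auto
    moreover have "{y \<in> \<phi> ` S. h y \<in> T} = {y \<in> D. y \<in> \<phi> ` S \<and> h y \<in> T}" using assms(3) by auto
    ultimately show "w ^ card {x \<in> S. h (\<phi> x) \<in> T} = (\<Prod>y\<in>D. if y \<in> \<phi> ` S \<and> h y \<in> T then w else 1)"
      using assms(1) by (simp add: prod.If_cases Int_def)
  qed
  also have "\<dots> = (\<Prod>y\<in>D. \<Sum>z\<in>B. if y \<in> \<phi> ` S \<and> z \<in> T then w else 1)"
    using assms by (subst prod_sum_PiE) auto
  also have "\<dots> = (\<Prod>y\<in>D. if y \<in> \<phi> ` S then card B + (w - 1) * card T else card B)"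
  proof (rule prod.cong[OF refl])
    fix y
    have "(\<Sum>z\<in>B. if z \<in> T then w else 1) = (\<Sum>z\<in>B. 1 + (w - 1) * of_bool (z \<in> T))"
      by (intro sum.cong) auto
    also have "\<dots> = card B + (w - 1) * card T"
      using assms by (simp add: sum.distrib sum_distrib_left[symmetric] Int_absorb1)
    finally show "(\<Sum>z\<in>B. if y \<in> \<phi> ` S \<and> z \<in> T then w else 1) =
        (if y \<in> \<phi> ` S then card B + (w - 1) * card T else card B)" by simp
  qed
  also have "\<dots> = (card B + (w - 1) * card T) ^ card S * real (card B) ^ (card D - card S)"
    using assms(1,3) fin cS
    by (simp add: prod.If_cases Int_absorb1 card_Diff_subset flip: Diff_eq)
  finally show ?thesis by simp
qed

text \<open>Chernoff's method: Markov's inequality for w to the power of the count, followed by 1 +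
  x \<le> exp x. The hypothesis on \<open>E\<close> covers upper tails (w \<ge> 1) and lower tails
  (w \<le> 1) alike.\<close>

lemma card_exponential_tail:
  fixes w t :: real
  assumes "finite D" "finite B" "B \<noteq> {}" "\<phi> ` S \<subseteq> D" "inj_on \<phi> S" "T \<subseteq> B" "0 < w"
    and E: "E \<subseteq> D \<rightarrow>\<^sub>E B" "\<And>h. h \<in> E \<Longrightarrow> w powr t \<le> w ^ card {x \<in> S. h (\<phi> x) \<in> T}"
  shows "card E \<le> card (D \<rightarrow>\<^sub>E B) * exp ((w - 1) * (card T / card B) * card S - t * ln w)"
proof -
  let ?p = "card T / card B"
  have b: "0 < card B" using assms by (simp add: card_gt_0_iff)
  have p: "0 \<le> 1 + (w - 1) * ?p"
  proof -
    have "?p \<le> 1" using b card_mono[OF assms(2,6)] by (simp add: field_simps)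
    then have "0 \<le> (1 - ?p) + w * ?p" using \<open>0 < w\<close> by (intro add_nonneg_nonneg) auto
    also have "(1 - x) + w * x = 1 + (w - 1) * x" for x by algebra
    finally show ?thesis .
  qed
  have cS: "card S \<le> card D" using card_inj_on_le[OF assms(5,4,1)] .
  have finE: "finite (D \<rightarrow>\<^sub>E B)" using assms by (intro finite_PiE) auto
  have "card E * w powr t = (\<Sum>h\<in>E. w powr t)" by simp
  also have "\<dots> \<le> (\<Sum>h\<in>E. w ^ card {x \<in> S. h (\<phi> x) \<in> T})" by (rule sum_mono[OF E(2)])
  also have "\<dots> \<le> (\<Sum>h\<in>D \<rightarrow>\<^sub>E B. w ^ card {x \<in> S. h (\<phi> x) \<in> T})"
    using E(1) finE \<open>0 < w\<close> by (intro sum_mono2) auto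
  also have "\<dots> = real (card B) ^ (card D - card S) * (card B + (w - 1) * card T) ^ card S"
    by (rule sum_PiE_power_card[OF assms(1,2,4,5,6)])
  also have "card B + (w - 1) * card T = card B * (1 + (w - 1) * ?p)"
    using b by (simp add: field_simps)
  also have "real (card B) ^ (card D - card S) * (card B * (1 + (w - 1) * ?p)) ^ card S =
      real (card B) ^ card D * (1 + (w - 1) * ?p) ^ card S"
    using cS by (simp add: power_mult_distrib mult.assoc[symmetric] power_add[symmetric] del: times_divide_eq_right)
  also have "\<dots> \<le> real (card B) ^ card D * exp ((w - 1) * ?p) ^ card S"
    using p exp_ge_add_one_self[of "(w - 1) * ?p"] by (intro mult_left_mono power_mono) auto
  also have "real (card B) ^ card D = card (D \<rightarrow>\<^sub>E B)" using assms(1) by (simp add: card_PiE)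
  also have "exp ((w - 1) * ?p) ^ card S = exp ((w - 1) * ?p * card S)"
    by (simp add: exp_of_nat_mult[symmetric] mult.commute)
  finally have "card E * w powr t \<le> card (D \<rightarrow>\<^sub>E B) * exp ((w - 1) * ?p * card S)" .
  then have "card E \<le> card (D \<rightarrow>\<^sub>E B) * exp ((w - 1) * ?p * card S) / exp (t * ln w)"
    using \<open>0 < w\<close> by (simp add: powr_def field_simps)
  then show ?thesis by (simp add: exp_diff)
qed

lemma card_upper_tail:
  fixes w t :: real
  assumes "finite D" "finite B" "B \<noteq> {}" "\<phi> ` S \<subseteq> D" "inj_on \<phi> S" "T \<subseteq> B" "1 \<le> w"
  shows "card {h \<in> D \<rightarrow>\<^sub>E B. t \<le> card {x \<in> S. h (\<phi> x) \<in> T}}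
    \<le> card (D \<rightarrow>\<^sub>E B) * exp ((w - 1) * (card T / card B) * card S - t * ln w)"
proof (rule card_exponential_tail[OF assms(1-6)])
  show "w powr t \<le> w ^ card {x \<in> S. h (\<phi> x) \<in> T}"
    if "h \<in> {h \<in> D \<rightarrow>\<^sub>E B. t \<le> card {x \<in> S. h (\<phi> x) \<in> T}}" for h
    using assms(7) that powr_mono[of t "real (card {x \<in> S. h (\<phi> x) \<in> T})" w]
    by (simp add: powr_realpow)
qed (use assms(7) in auto)

lemma card_lower_tail:
  fixes w t :: real
  assumes "finite D" "finite B" "B \<noteq> {}" "\<phi> ` S \<subseteq> D" "inj_on \<phi> S" "T \<subseteq> B" "0 < w" "w \<le> 1"
  shows "card {h \<in> D \<rightarrow>\<^sub>E B. card {x \<in> S. h (\<phi> x) \<in> T} \<le> t}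
    \<le> card (D \<rightarrow>\<^sub>E B) * exp ((w - 1) * (card T / card B) * card S - t * ln w)"
proof (rule card_exponential_tail[OF assms(1-7)])
  show "w powr t \<le> w ^ card {x \<in> S. h (\<phi> x) \<in> T}"
    if "h \<in> {h \<in> D \<rightarrow>\<^sub>E B. card {x \<in> S. h (\<phi> x) \<in> T} \<le> t}" for h
    using assms(7,8) that powr_mono'[of "real (card {x \<in> S. h (\<phi> x) \<in> T})" t w]
    by (simp add: powr_realpow)
qed auto

text \<open>
  A random choice of sample points fails a fixed test with probability at most
  \<open>exp (- \<beta> * card J)\<close>, so a union bound applies to exponentially many tests.
\<close>

lemma ex_sample:
  fixes \<beta> :: real
  assumes "finite \<Omega>" "\<Omega> \<noteq> {}" "finite J" "finite \<T>"
    and \<T>: "\<And>E. E \<in> \<T> \<Longrightarrow> E \<subseteq> \<Omega> \<and> card E \<le> \<beta> * card \<Omega>"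
    and "0 \<le> \<beta>" "card \<T> < exp (\<beta> * card J)"
  shows "\<exists>s \<in> J \<rightarrow>\<^sub>E \<Omega>. \<forall>E\<in>\<T>. card {x \<in> J. s x \<in> E} \<le> 4 * \<beta> * card J"
proof (rule ccontr)
  let ?P = "J \<rightarrow>\<^sub>E \<Omega>"
  let ?bad = "\<lambda>E. {s \<in> ?P. 4 * \<beta> * card J \<le> card {x \<in> J. s (id x) \<in> E}}"
  assume neg: "\<not> ?thesis"
  have "s \<in> (\<Union>E\<in>\<T>. ?bad E)" if s: "s \<in> ?P" for s
  proof -
    obtain E where "E \<in> \<T>" "\<not> card {x \<in> J. s x \<in> E} \<le> 4 * \<beta> * card J"
      using neg s by blast
    then have "s \<in> ?bad E" using s by simp
    then show ?thesis using \<open>E \<in> \<T>\<close> by (rule UN_I[rotated])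
  qed
  then have "?P \<subseteq> (\<Union>E\<in>\<T>. ?bad E)" by (rule subsetI)
  moreover have "(\<Union>E\<in>\<T>. ?bad E) \<subseteq> ?P" by (rule UN_least) simp
  ultimately have eq: "?P = (\<Union>E\<in>\<T>. ?bad E)" by (rule equalityI)
  have bad: "card (?bad E) \<le> card ?P * exp (- \<beta> * card J)" if E: "E \<in> \<T>" for E
  proof -
    \<comment> \<open>With base 2 the exponent is at most \<beta> * card J * (1 - 4 ln 2), and ln 2
      \<ge> 1/2; this is where the factor 4 comes from.\<close>
    have "(2 - 1) * (card E / card \<Omega>) * card J - 4 * \<beta> * card J * ln 2 \<le> - \<beta> * card J"
    proof -
      have "card E / card \<Omega> \<le> \<beta>"
        using \<T>[OF E] assms(1,2) by (simp add: card_gt_0_iff divide_le_eq)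
      then have "(card E / card \<Omega>) * card J \<le> \<beta> * card J" by (rule mult_right_mono) simp
      moreover have "4 * \<beta> * card J * (1 / 2) \<le> 4 * \<beta> * card J * ln 2"
        using \<open>0 \<le> \<beta>\<close> ln2_ge_two_thirds by (intro mult_left_mono) auto
      ultimately show ?thesis by simp
    qed
    moreover have "card (?bad E) \<le> card ?P * exp ((2 - 1) * (card E / card \<Omega>) * card J - 4 * \<beta> * card J * ln 2)"
      by (rule card_upper_tail) (use assms \<T>[OF E] in auto)
    ultimately show ?thesis
      by (meson exp_le_cancel_iff mult_left_mono of_nat_0_le_iff order_trans)
  qed
  have "real (card ?P) = card (\<Union>E\<in>\<T>. ?bad E)" using eq by (rule arg_cong)
  also have "\<dots> \<le> (\<Sum>E\<in>\<T>. card (?bad E))" using card_UN_le[OF assms(4), of ?bad] by linarith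
  also have "\<dots> \<le> (\<Sum>E\<in>\<T>. card ?P * exp (- \<beta> * card J))"
    by (simp only: of_nat_sum) (rule sum_mono[OF bad])
  also have "\<dots> = card ?P * (card \<T> * exp (- \<beta> * card J))" by simp
  also have "\<dots> < real (card ?P) * 1"
  proof (rule mult_strict_left_mono)
    show "card \<T> * exp (- \<beta> * card J) < 1"
      using assms(7) by (simp add: exp_minus field_simps)
    show "0 < real (card ?P)" using assms by (simp add: card_PiE card_gt_0_iff)
  qed
  finally show False by simp
qed

text \<open>Base 2 gives the exponent p K (1 - 2 ln 2), which is at most - p K / 3.\<close>

lemma card_double_tail:
  fixes K p \<kappa> :: real
  assumes "finite D" "finite B" "B \<noteq> {}" "\<phi> ` S \<subseteq> D" "inj_on \<phi> S" "T \<subseteq> B"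
    and S: "card S \<le> K" and T: "card T \<le> p * card B" and \<kappa>: "4 * \<kappa> \<le> p * K"
  shows "card {h \<in> D \<rightarrow>\<^sub>E B. 2 * K * p < card {x \<in> S. h (\<phi> x) \<in> T}} \<le> card (D \<rightarrow>\<^sub>E B) * exp (- \<kappa>)"
proof -
  let ?P = "D \<rightarrow>\<^sub>E B"
  have b: "0 < card B" using assms by (simp add: card_gt_0_iff)
  have p: "0 \<le> p" using T b by (metis mult_less_0_iff of_nat_0_le_iff of_nat_0_less_iff order_trans linorder_not_le)
  have K: "0 \<le> K" using S by linarith
  have "card T / card B * card S \<le> p * K"
    using S T b p by (intro mult_mono) (auto simp: field_simps)
  moreover have "2 * K * p * (2 / 3) \<le> 2 * K * p * ln 2"
    using K p ln2_ge_two_thirds by (intro mult_left_mono) auto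
  moreover have "0 \<le> p * K" using p K by simp
  ultimately have e: "(2 - 1) * (card T / card B) * card S - 2 * K * p * ln 2 \<le> - \<kappa>"
    using \<kappa> by (simp add: algebra_simps)
  have "card {h \<in> ?P. 2 * K * p < card {x \<in> S. h (\<phi> x) \<in> T}}
      \<le> card {h \<in> ?P. 2 * K * p \<le> card {x \<in> S. h (\<phi> x) \<in> T}}"
    using assms(1,2) by (intro card_mono) (auto intro!: finite_PiE)
  also have "real \<dots> \<le> card ?P * exp ((2 - 1) * (card T / card B) * card S - 2 * K * p * ln 2)"
    by (rule card_upper_tail[OF assms(1-6)]) simp
  also have "\<dots> \<le> card ?P * exp (- \<kappa>)" using e by (intro mult_left_mono) auto
  finally show ?thesis by simp
qed

text \<open>Base 1/2 gives the exponent - p * card S * (1 - ln 2) / 2, and (1 - ln 2) / 2 exceeds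
  1/8.\<close>

lemma card_half_tail:
  fixes p \<kappa> :: real
  assumes "finite D" "finite B" "B \<noteq> {}" "\<phi> ` S \<subseteq> D" "inj_on \<phi> S" "T \<subseteq> B"
    and T: "card T = p * card B" and \<kappa>: "8 * \<kappa> \<le> p * card S"
  shows "card {h \<in> D \<rightarrow>\<^sub>E B. card {x \<in> S. h (\<phi> x) \<in> T} < p * card S / 2} \<le> card (D \<rightarrow>\<^sub>E B) * exp (- \<kappa>)"
proof -
  let ?P = "D \<rightarrow>\<^sub>E B"
  have b: "0 < card B" using assms by (simp add: card_gt_0_iff)
  have p: "card T / card B = p" using T b by simp
  then have p0: "0 \<le> p" by (metis divide_nonneg_nonneg of_nat_0_le_iff)
  have "(p * card S / 2) * ln 2 \<le> (p * card S / 2) * (25 / 36)"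
    using p0 ln2_le_25_over_36 by (intro mult_left_mono) auto
  moreover have "0 \<le> p * card S" using p0 by simp
  ultimately have e: "(1 / 2 - 1) * p * card S - (p * card S / 2) * ln (1 / 2) \<le> - \<kappa>"
    using \<kappa> by (simp add: ln_div algebra_simps)
  have "card {h \<in> ?P. card {x \<in> S. h (\<phi> x) \<in> T} < p * card S / 2}
      \<le> card {h \<in> ?P. card {x \<in> S. h (\<phi> x) \<in> T} \<le> p * card S / 2}"
    using assms(1,2) by (intro card_mono) (auto intro!: finite_PiE)
  also have "real \<dots> \<le> card ?P * exp ((1 / 2 - 1) * (card T / card B) * card S - (p * card S / 2) * ln (1 / 2))"
    by (rule card_lower_tail[OF assms(1-6)]) auto
  also have "\<dots> \<le> card ?P * exp (- \<kappa>)" using e unfolding p by (intro mult_left_mono) auto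
  finally show ?thesis by simp
qed

section \<open>Hashing vertices and colours into bins\<close>

text \<open>
  One hash function \<open>h\<close> with values below \<open>q * r\<close> serves for the vertices (at even arguments) and for
  the colours (at odd arguments). A vertex bin \<open>i < q\<close> takes \<open>r - 1\<close> of the values and a colour bin
  takes \<open>r\<close>, which gives the colours their advantage. The vertices with \<open>vertex_bin r h v \<ge> q\<close> are the
  leftover ones.
\<close>

definition vertex_bin :: "nat \<Rightarrow> (nat \<Rightarrow> nat) \<Rightarrow> nat \<Rightarrow> nat" where
  "vertex_bin r h v = h (2 * v) div (r - 1)"

definition colour_bin :: "nat \<Rightarrow> (nat \<Rightarrow> nat) \<Rightarrow> nat \<Rightarrow> nat" where
  "colour_bin r h x = h (2 * x + 1) div r"

text \<open>
  \<open>U\<close> is the set of active vertices, \<open>S\<close> the set of active neighbours of a vertex, and \<open>P\<close> its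
  remaining palette.
\<close>

definition good_hash ::
  "nat \<Rightarrow> nat \<Rightarrow> real \<Rightarrow> real \<Rightarrow> real \<Rightarrow> nat set \<Rightarrow> nat set \<Rightarrow> nat set \<Rightarrow> (nat \<Rightarrow> nat) \<Rightarrow> bool" where
  "good_hash q r N K D U S P h \<longleftrightarrow>
     (\<forall>i<q. card {u \<in> U. vertex_bin r h u = i} \<le> 2 * N * (1 / q) \<and>
            card {u \<in> S. vertex_bin r h u = i} \<le> 2 * K * (1 / q) \<and>
            card {u \<in> S. vertex_bin r h u = i} < card {x \<in> P. colour_bin r h x = i}) \<and>
     card {u \<in> U. q \<le> vertex_bin r h u} \<le> 2 * N * (1 / r) \<and>
     card {u \<in> S. q \<le> vertex_bin r h u} \<le> 2 * K * (1 / r) \<and>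
     (card P \<le> 2 * card S \<longrightarrow> D / (4 * real r) \<le> card {u \<in> S. q \<le> vertex_bin r h u})"

lemma div_eq_iff_interval: "0 < m \<Longrightarrow> s div m = i \<longleftrightarrow> i * m \<le> s \<and> s < i * m + (m :: nat)"
  by (metis add.commute div_nat_eqI dividend_less_times_div div_times_less_eq_dividend mult.commute mult_Suc)

text \<open>A union bound over 4 q + 3 failures: four for each bin and three for the leftover
  vertices. That the neighbours in a bin reach the number of colours there is split at a threshold
  into two one-sided tails, one for the vertices and one for the colours.\<close>

lemma card_bad_hash:
  fixes N K D \<kappa> :: real
  assumes "0 \<le> \<kappa>" and r: "2 \<le> r" and q: "0 < q"
    and sub: "U \<subseteq> {..<X}" "S \<subseteq> {..<X}" "P \<subseteq> {..<X}"
    and sizes: "card U \<le> N" "card S \<le> K" "card S < card P" "D \<le> card P"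
    and "4 * \<kappa> \<le> N / q" "4 * \<kappa> \<le> K / q" "4 * \<kappa> \<le> N / r" "4 * \<kappa> \<le> K / r"
    and D: "32 * \<kappa> \<le> D / (q * real r ^ 2)" "16 * \<kappa> \<le> D / r"
  shows "card {h \<in> {..<2 * X} \<rightarrow>\<^sub>E {..<q * r}. \<not> good_hash q r N K D U S P h}
    \<le> (4 * real q + 3) * exp (- \<kappa>) * card ({..<2 * X} \<rightarrow>\<^sub>E {..<q * r})"
proof -
  let ?D = "{..<2 * X}" and ?B = "{..<q * r}"
  let ?P = "?D \<rightarrow>\<^sub>E ?B"
  define M where "M i = {s \<in> ?B. s div (r - 1) = i}" for i
  define L where "L = {s \<in> ?B. q \<le> s div (r - 1)}"
  define C where "C i = {s \<in> ?B. s div r = i}" for i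
  let ?v = "\<lambda>v :: nat. 2 * v" and ?c = "\<lambda>x :: nat. 2 * x + 1"
  have fin: "finite ?D" "finite ?B" "?B \<noteq> {}" using q r by (auto simp: lessThan_empty_iff)
  have B: "real (card ?B) = q * r" by simp
  have MLC: "M i \<subseteq> ?B" "L \<subseteq> ?B" "C i \<subseteq> ?B" for i by (auto simp: M_def L_def C_def)
  have "M i \<subseteq> {i * (r - 1)..<i * (r - 1) + (r - 1)}" for i
    using r by (auto simp: M_def div_eq_iff_interval)
  from card_mono[OF _ this] have cM: "card (M i) \<le> r - 1" for i by simp
  \<comment> \<open>The q vertex bins take r - 1 values each, which leaves q of the q * r values, a
    fraction 1 / r.\<close>
  have "L = {q * (r - 1)..<q * r}"
    using r by (auto simp: L_def less_eq_div_iff_mult_less_eq)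
  then have "card L = q * r - q * (r - 1)" by simp
  also have "\<dots> = q" using r by (simp add: right_diff_distrib')
  finally have cL: "card L = q" .
  have "C i = {i * r..<i * r + r}" if "i < q" for i
  proof -
    have "i * r + r \<le> q * r" using mult_le_mono1[of "Suc i" q r] that by simp
    then show ?thesis using r by (auto simp: C_def div_eq_iff_interval)
  qed
  then have cC: "card (C i) = r" if "i < q" for i using that by simp
  have vsub: "?v ` U \<subseteq> ?D" "?v ` S \<subseteq> ?D" "?c ` P \<subseteq> ?D" using sub by auto
  have inj: "inj_on ?v A" "inj_on ?c A" for A by (auto simp: inj_on_def)
  define m where "m = card P / q"
  \<comment> \<open>halfway between the expected number \<open>m\<close> of colours in a bin and the bound
    \<open>m * (1 - 1 / r)\<close> on the expected number of neighbours in it\<close>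
  define \<tau> where "\<tau> = m * (1 - 1 / (2 * real r))"
  define E1 where "E1 i = {h \<in> ?P. 2 * N * (1 / q) < card {u \<in> U. h (?v u) \<in> M i}}" for i
  define E2 where "E2 i = {h \<in> ?P. 2 * K * (1 / q) < card {u \<in> S. h (?v u) \<in> M i}}" for i
  define E3 where "E3 i = {h \<in> ?P. \<tau> \<le> card {u \<in> S. h (?v u) \<in> M i}}" for i
  define E4 where "E4 i = {h \<in> ?P. card {x \<in> P. h (?c x) \<in> C i} \<le> \<tau>}" for i
  define E5 where "E5 = {h \<in> ?P. 2 * N * (1 / r) < card {u \<in> U. h (?v u) \<in> L}}"
  define E6 where "E6 = {h \<in> ?P. 2 * K * (1 / r) < card {u \<in> S. h (?v u) \<in> L}}"
  \<comment> \<open>Few neighbours give no useful lower tail, so the event is confined to the case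
    where S has at least half the size of P, and hence at least D / 2 elements.\<close>
  define E7 where "E7 = (if card P \<le> 2 * card S
    then {h \<in> ?P. card {u \<in> S. h (?v u) \<in> L} < 1 / r * card S / 2} else {})"
  let ?x = "card ?P * exp (- \<kappa>)"
  have r0: "real r \<noteq> 0" "2 \<le> real r" using r by auto
  have m0: "0 \<le> m" by (simp add: m_def)
  have pM: "real (card (M i)) \<le> 1 / q * card ?B" for i
    using cM[of i] q r by simp
  have pL: "real (card L) = 1 / r * card ?B" using cL r by simp
  have E12: "card (E1 i) \<le> ?x" "card (E2 i) \<le> ?x" for i
    unfolding E1_def E2_def
    by (rule card_double_tail[OF fin vsub(1) inj(1) MLC(1) sizes(1) pM]; use assms in simp)
      (rule card_double_tail[OF fin vsub(2) inj(1) MLC(1) sizes(2) pM]; use assms in simp)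
  have E56: "card E5 \<le> ?x" "card E6 \<le> ?x"
    unfolding E5_def E6_def
    by (rule card_double_tail[OF fin vsub(1) inj(1) MLC(2) sizes(1) eq_refl[OF pL]]; use assms in simp)
      (rule card_double_tail[OF fin vsub(2) inj(1) MLC(2) sizes(2) eq_refl[OF pL]]; use assms in simp)
  have E7: "card E7 \<le> ?x"
  proof (cases "card P \<le> 2 * card S")
    case True
    have "8 * \<kappa> \<le> D / (2 * r)" using D(2) r by (simp add: field_simps)
    also have "\<dots> \<le> card P / (2 * r)" using sizes(4) by (intro divide_right_mono) auto
    also have "\<dots> \<le> (2 * card S) / (2 * r)" using True by (intro divide_right_mono) linarith+
    also have "\<dots> = 1 / r * card S" by simp
    finally have "8 * \<kappa> \<le> 1 / r * card S" .
    from card_half_tail[OF fin vsub(2) inj(1) MLC(2) pL this] show ?thesis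
      using True by (simp add: E7_def)
  qed (simp add: E7_def)
  have "D / (q * real r ^ 2) \<le> card P / (q * real r ^ 2)"
    using sizes(4) by (intro divide_right_mono) auto
  with D(1) have \<kappa>: "32 * \<kappa> \<le> m / real r ^ 2" by (simp add: m_def)
  have E3: "card (E3 i) \<le> ?x" for i
  proof -
    \<comment> \<open>The Chernoff base is 1 + e. The mean is at most m (1 - 4 e) and the threshold
      is m (1 - 2 e); with ln (1 + e) \<ge> e - e^2 the exponent is at most - m e^2 = - m / (16
      r^2).\<close>
    define e where "e = 1 / (4 * real r)"
    have e: "0 < e" "e \<le> 1 / 8" "1 / real r = 4 * e" "1 / (2 * real r) = 2 * e"
      using r0 by (auto simp: e_def field_simps)
    have "card (M i) / card ?B * card S \<le> ((real r - 1) / (q * r)) * card P"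
      using cM[of i] sizes(3) r q by (intro mult_mono divide_mono) (auto simp: of_nat_diff)
    also have "\<dots> = m * (1 - 1 / real r)" using r0 q by (simp add: m_def field_simps)
    also have "\<dots> = m * (1 - 4 * e)" by (simp only: e(3))
    finally have "e * (card (M i) / card ?B * card S) \<le> e * (m * (1 - 4 * e))"
      using e by (intro mult_left_mono) auto
    moreover have "\<tau> * (e - e\<^sup>2) \<le> \<tau> * ln (1 + e)"
      using e m0 ln_one_plus_pos_lower_bound[of e] by (intro mult_left_mono) (auto simp: \<tau>_def e(4))
    moreover have "\<tau> * (e - e\<^sup>2) = m * (1 - 2 * e) * (e - e\<^sup>2)" by (simp add: \<tau>_def e(4))
    moreover have "e * (m * (1 - 4 * e)) - m * (1 - 2 * e) * (e - e\<^sup>2) = - m * (e\<^sup>2 + 2 * e ^ 3)"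
      by algebra
    moreover have "m * e\<^sup>2 \<le> m * (e\<^sup>2 + 2 * e ^ 3)" using e m0 by (intro mult_left_mono) auto
    moreover have "\<kappa> \<le> m * e\<^sup>2"
    proof -
      have "m * e\<^sup>2 = m / real r ^ 2 / 16" by (simp add: e_def power2_eq_square)
      then show ?thesis using \<kappa> \<open>0 \<le> \<kappa>\<close> by simp
    qed
    ultimately have ex: "(1 + e - 1) * (card (M i) / card ?B) * card S - \<tau> * ln (1 + e) \<le> - \<kappa>"
      by (simp add: mult.assoc)
    have "card (E3 i) \<le> card ?P * exp ((1 + e - 1) * (card (M i) / card ?B) * card S - \<tau> * ln (1 + e))"
      unfolding E3_def by (rule card_upper_tail[OF fin vsub(2) inj(1) MLC(1)]) (use e in simp)
    also have "\<dots> \<le> ?x" by (rule mult_left_mono) (use ex in simp_all)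
    finally show ?thesis .
  qed
  have E4: "card (E4 i) \<le> ?x" if i: "i < q" for i
  proof -
    \<comment> \<open>The base is 1 - e, the mean m and the threshold m (1 - 4 e). The exponent is
      at most - 2 m e^2 = - m / (32 r^2), which is the source of the 32 in the hypothesis on
      \<open>D\<close>.\<close>
    define e where "e = 1 / (8 * real r)"
    have e: "0 < e" "e \<le> 1 / 16" "1 / (2 * real r) = 4 * e"
      using r0 by (auto simp: e_def field_simps)
    have m: "card (C i) / card ?B * card P = m" using cC[OF i] r q by (simp add: m_def)
    have "\<tau> * (- e - 2 * e\<^sup>2) \<le> \<tau> * ln (1 - e)"
      using e m0 ln_one_minus_pos_lower_bound[of e] by (intro mult_left_mono) (auto simp: \<tau>_def e(3))
    moreover have "\<tau> * (- e - 2 * e\<^sup>2) = m * (1 - 4 * e) * (- e - 2 * e\<^sup>2)" by (simp add: \<tau>_def e(3))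
    moreover have "(- e) * m - m * (1 - 4 * e) * (- e - 2 * e\<^sup>2) = - m * (2 * e\<^sup>2 + 8 * e ^ 3)"
      by algebra
    moreover have "m * (2 * e\<^sup>2) \<le> m * (2 * e\<^sup>2 + 8 * e ^ 3)" using e m0 by (intro mult_left_mono) auto
    moreover have "\<kappa> \<le> m * (2 * e\<^sup>2)"
    proof -
      have "m * (2 * e\<^sup>2) = m / real r ^ 2 / 32" by (simp add: e_def power2_eq_square)
      then show ?thesis using \<kappa> by simp
    qed
    ultimately have "(- e) * m - \<tau> * ln (1 - e) \<le> - \<kappa>" by linarith
    moreover have "(1 - e - 1) * (card (C i) / card ?B) * card P = (- e) * m"
      unfolding m[symmetric] by simp
    ultimately have ex: "(1 - e - 1) * (card (C i) / card ?B) * card P - \<tau> * ln (1 - e) \<le> - \<kappa>"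
      by simp
    have "card (E4 i) \<le> card ?P * exp ((1 - e - 1) * (card (C i) / card ?B) * card P - \<tau> * ln (1 - e))"
      unfolding E4_def by (rule card_lower_tail[OF fin vsub(3) inj(2) MLC(3)]) (use e in simp_all)
    also have "\<dots> \<le> ?x" by (rule mult_left_mono) (use ex in simp_all)
    finally show ?thesis .
  qed
  have vb: "{u \<in> W. h (?v u) \<in> M i} = {u \<in> W. vertex_bin r h u = i}"
    "{u \<in> W. h (?v u) \<in> L} = {u \<in> W. q \<le> vertex_bin r h u}"
    "{u \<in> W. h (?c u) \<in> C i} = {u \<in> W. colour_bin r h u = i}"
    if "h \<in> ?P" "W \<subseteq> {..<X}" for h W i
  proof -
    have "h (?v u) < q * r" "h (?c u) < q * r" if "u \<in> W" for u
      using \<open>W \<subseteq> {..<X}\<close> that PiE_mem[OF \<open>h \<in> ?P\<close>, of "?v u"] PiE_mem[OF \<open>h \<in> ?P\<close>, of "?c u"]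
      by auto
    then show "{u \<in> W. h (?v u) \<in> M i} = {u \<in> W. vertex_bin r h u = i}"
      "{u \<in> W. h (?v u) \<in> L} = {u \<in> W. q \<le> vertex_bin r h u}"
      "{u \<in> W. h (?c u) \<in> C i} = {u \<in> W. colour_bin r h u = i}"
      by (auto simp: M_def L_def C_def vertex_bin_def colour_bin_def)
  qed
  have "{h \<in> ?P. \<not> good_hash q r N K D U S P h} \<subseteq>
      (\<Union>i\<in>{..<q}. E1 i \<union> E2 i \<union> (E3 i \<union> E4 i)) \<union> (E5 \<union> E6 \<union> E7)" (is "?bad \<subseteq> ?E")
  proof
    fix h assume "h \<in> ?bad"
    then have h: "h \<in> ?P" and bad: "\<not> good_hash q r N K D U S P h" by auto
    show "h \<in> ?E"
    proof (rule ccontr)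
      assume no: "h \<notin> ?E"
      have "good_hash q r N K D U S P h"
        unfolding good_hash_def
      proof (intro conjI allI impI)
        fix i assume i: "i < q"
        then have "h \<notin> E1 i" "h \<notin> E2 i" "h \<notin> E3 i" "h \<notin> E4 i" using no i by auto
        then show "card {u \<in> U. vertex_bin r h u = i} \<le> 2 * N * (1 / q)"
          "card {u \<in> S. vertex_bin r h u = i} \<le> 2 * K * (1 / q)"
          "card {u \<in> S. vertex_bin r h u = i} < card {x \<in> P. colour_bin r h x = i}"
          using h vb(3)[OF h sub(3), of i] by (simp_all add: E1_def E2_def E3_def E4_def vb sub)
      next
        have "h \<notin> E5" using no by auto
        then show "card {u \<in> U. q \<le> vertex_bin r h u} \<le> 2 * N * (1 / r)"
          using h by (simp add: E5_def vb sub)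
      next
        have "h \<notin> E6" using no by auto
        then show "card {u \<in> S. q \<le> vertex_bin r h u} \<le> 2 * K * (1 / r)"
          using h by (simp add: E6_def vb sub)
      next
        assume c: "card P \<le> 2 * card S"
        have "h \<notin> E7" using no by auto
        then have *: "1 / r * card S / 2 \<le> card {u \<in> S. q \<le> vertex_bin r h u}"
          using h c by (simp add: E7_def vb sub not_less)
        have "D \<le> 2 * real (card S)" using sizes(4) c by linarith
        then have "D / (4 * real r) \<le> 2 * real (card S) / (4 * real r)" by (rule divide_right_mono) simp
        also have "\<dots> = 1 / r * card S / 2" by simp
        finally show "D / (4 * real r) \<le> card {u \<in> S. q \<le> vertex_bin r h u}" using * by linarith
      qed
      with bad show False by simp
    qed
  qed
  moreover have "finite ?E"
  proof (rule finite_subset)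
    show "?E \<subseteq> ?P" by (auto simp: E1_def E2_def E3_def E4_def E5_def E6_def E7_def split: if_splits)
    show "finite ?P" using fin by (intro finite_PiE) auto
  qed
  ultimately have "card ?bad \<le> card ?E" by (rule card_mono[rotated])
  also have "real \<dots> \<le> real (card (\<Union>i\<in>{..<q}. E1 i \<union> E2 i \<union> (E3 i \<union> E4 i))) + real (card E5 + card E6 + card E7)"
    using card_Un_le[of "\<Union>i\<in>{..<q}. E1 i \<union> E2 i \<union> (E3 i \<union> E4 i)" "E5 \<union> E6 \<union> E7"]
      card_Un_le[of "E5 \<union> E6" E7] card_Un_le[of E5 E6] by linarith
  also have "\<dots> \<le> q * (4 * ?x) + 3 * ?x"
  proof (rule add_mono)
    have "real (card (\<Union>i\<in>{..<q}. E1 i \<union> E2 i \<union> (E3 i \<union> E4 i))) \<le>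
        real (\<Sum>i<q. card (E1 i \<union> E2 i \<union> (E3 i \<union> E4 i)))"
      by (intro of_nat_mono card_UN_le) simp
    also have "\<dots> = (\<Sum>i<q. real (card (E1 i \<union> E2 i \<union> (E3 i \<union> E4 i))))" by (rule of_nat_sum)
    also have "\<dots> \<le> (\<Sum>i<q. 4 * ?x)"
    proof (rule sum_mono)
      fix i assume "i \<in> {..<q}"
      then show "card (E1 i \<union> E2 i \<union> (E3 i \<union> E4 i)) \<le> 4 * ?x"
        using card_Un_le[of "E1 i \<union> E2 i" "E3 i \<union> E4 i"] card_Un_le[of "E1 i" "E2 i"]
          card_Un_le[of "E3 i" "E4 i"] E12[of i] E3[of i] E4[of i] by simp
    qed
    finally show "real (card (\<Union>i\<in>{..<q}. E1 i \<union> E2 i \<union> (E3 i \<union> E4 i))) \<le> q * (4 * ?x)" by simp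
    show "real (card E5 + card E6 + card E7) \<le> 3 * ?x" using E56 E7 by simp
  qed
  finally show ?thesis by (simp add: algebra_simps)
qed

section \<open>The levels of the algorithm\<close>

text \<open>The family depends on the bounds only and not on the graph, so it can be fixed in
  advance. There are at most 8^X triples \<open>(U, S, P)\<close>, hence at most exp (3 X) tests;
  this explains the demand on \<open>card J\<close>.\<close>

lemma ex_hash_family:
  fixes N K D \<kappa> \<beta> :: real
  assumes "0 \<le> \<kappa>" "2 \<le> r" "0 < q" "4 * \<kappa> \<le> N / q" "4 * \<kappa> \<le> K / q" "4 * \<kappa> \<le> N / r" "4 * \<kappa> \<le> K / r"
    "32 * \<kappa> \<le> D / (q * real r ^ 2)" "16 * \<kappa> \<le> D / r"
    and \<beta>: "(4 * real q + 3) * exp (- \<kappa>) \<le> \<beta>" and J: "finite J" "3 * real X < \<beta> * card J"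
  shows "\<exists>F. \<forall>U S P. U \<subseteq> {..<X} \<longrightarrow> S \<subseteq> {..<X} \<longrightarrow> P \<subseteq> {..<X} \<longrightarrow> card U \<le> N \<longrightarrow> card S \<le> K \<longrightarrow>
    card S < card P \<longrightarrow> D \<le> card P \<longrightarrow>
    card {s \<in> J. \<not> good_hash q r N K D U S P (F s)} \<le> 4 * \<beta> * card J"
proof -
  let ?\<Omega> = "{..<2 * X} \<rightarrow>\<^sub>E {..<q * r}"
  let ?sub = "Pow {..<X} \<times> Pow {..<X} \<times> Pow {..<X}"
  define Tr where "Tr = {(U, S, P). (U, S, P) \<in> ?sub \<and> card U \<le> N \<and> card S \<le> K \<and>
      card S < card P \<and> D \<le> card P}"
  define bad where "bad = (\<lambda>(U, S, P). {h \<in> ?\<Omega>. \<not> good_hash q r N K D U S P h})"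
  have Tr: "Tr \<subseteq> ?sub" by (auto simp: Tr_def)
  then have fT: "finite Tr" by (rule finite_subset) simp
  have "card (bad ` Tr) \<le> card Tr" by (rule card_image_le[OF fT])
  also have "\<dots> \<le> card ?sub" using Tr by (intro card_mono) auto
  also have "\<dots> = 8 ^ X"
    by (simp add: card_cartesian_product card_Pow power_mult_distrib[symmetric])
  finally have "real (card (bad ` Tr)) \<le> real (8 ^ X)" by (simp only: of_nat_le_iff)
  also have "real (8 ^ X) = 8 ^ X" by simp
  also have "\<dots> \<le> exp 3 ^ X"
  proof (rule power_mono)
    have "(2::real) ^ 3 \<le> exp 1 ^ 3"
      using exp_ge_add_one_self[of 1] by (intro power_mono) auto
    then show "8 \<le> exp (3 :: real)" by (simp add: exp_of_nat_mult[symmetric])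
  qed simp
  also have "\<dots> = exp (3 * real X)" by (simp add: exp_of_nat_mult[symmetric] mult.commute)
  also have "\<dots> < exp (\<beta> * card J)" using J(2) by simp
  finally have few: "card (bad ` Tr) < exp (\<beta> * card J)" .
  have rare: "E \<subseteq> ?\<Omega> \<and> card E \<le> \<beta> * card ?\<Omega>" if E: "E \<in> bad ` Tr" for E
  proof -
    obtain U S P where t: "E = bad (U, S, P)" "(U, S, P) \<in> Tr" using E by auto
    have "card E \<le> (4 * real q + 3) * exp (- \<kappa>) * card ?\<Omega>"
      unfolding t(1) bad_def prod.case
      by (rule card_bad_hash) (use assms t(2) in \<open>auto simp: Tr_def\<close>)
    also have "\<dots> \<le> \<beta> * card ?\<Omega>" using \<beta> by (rule mult_right_mono) simp
    finally show ?thesis by (auto simp: t(1) bad_def)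
  qed
  have fin: "finite ?\<Omega>" by (intro finite_PiE) auto
  have ne: "?\<Omega> \<noteq> {}" using assms(2,3) by (simp add: PiE_eq_empty_iff lessThan_empty_iff)
  have "0 \<le> \<beta>" using \<beta> by (rule order_trans[rotated]) simp
  then have "\<exists>s\<in>J \<rightarrow>\<^sub>E ?\<Omega>. \<forall>E\<in>bad ` Tr. card {x \<in> J. s x \<in> E} \<le> 4 * \<beta> * card J"
    using few by (intro ex_sample[OF fin ne J(1) finite_imageI[OF fT]] rare)
  then obtain F where F: "F \<in> J \<rightarrow>\<^sub>E ?\<Omega>"
    "\<forall>E\<in>bad ` Tr. card {x \<in> J. F x \<in> E} \<le> 4 * \<beta> * card J"
    by (elim bexE)
  show ?thesis
  proof (intro exI[of _ F] allI impI)
    fix U S P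
    assume "U \<subseteq> {..<X}" "S \<subseteq> {..<X}" "P \<subseteq> {..<X}" "card U \<le> N" "card S \<le> K" "card S < card P" "D \<le> card P"
    then have "bad (U, S, P) \<in> bad ` Tr" by (auto simp: Tr_def)
    from bspec[OF F(2) this]
    have "card {s \<in> J. F s \<in> bad (U, S, P)} \<le> 4 * \<beta> * card J" .
    moreover have "{s \<in> J. F s \<in> bad (U, S, P)} = {s \<in> J. \<not> good_hash q r N K D U S P (F s)}"
      using PiE_mem[OF F(1)] by (auto simp: bad_def)
    ultimately show "card {s \<in> J. \<not> good_hash q r N K D U S P (F s)} \<le> 4 * \<beta> * card J"
      by simp
  qed
qed

section \<open>Integer part of the sixth root, and the parameters of the levels\<close>

definition root6 :: "nat \<Rightarrow> nat" where
  "root6 d = (LEAST r. d < (r + 1) ^ 6)"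

lemma root6: "d < (root6 d + 1) ^ 6" "root6 d ^ 6 \<le> d"
proof -
  have "d < (d + 1) ^ 6" using power_increasing[of 1 6 "d + 1"] by simp
  then show "d < (root6 d + 1) ^ 6" unfolding root6_def by (rule LeastI)
  show "root6 d ^ 6 \<le> d"
  proof (cases "root6 d")
    case (Suc r)
    then have "\<not> d < (r + 1) ^ 6" using not_less_Least[of r "\<lambda>r. d < (r + 1) ^ 6"] by (simp add: root6_def)
    then show ?thesis using Suc by simp
  qed simp
qed

lemma root6_succ_le: "1 \<le> root6 d \<Longrightarrow> (root6 d + 1) ^ 6 \<le> 64 * root6 d ^ 6"
  using power_mono[of "root6 d + 1" "2 * root6 d" 6] by (simp add: power_mult_distrib)

text \<open>It makes the universe of identifiers and colours polynomial in n, so that seeds of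
  constant length suffice.\<close>

lemma two_power_log_bits_le:
  assumes "2 \<le> n"
  shows "2 ^ log_bits n \<le> n ^ 3"
proof -
  have "real (log_bits n) \<le> log 2 (real n + 1) + 1"
  proof -
    have "0 \<le> log 2 (real n + 1)" by simp
    then show ?thesis unfolding log_bits_def by linarith
  qed
  then have "2 powr real (log_bits n) \<le> 2 powr (log 2 (real n + 1) + 1)" by (intro powr_mono) auto
  then have "2 ^ log_bits n \<le> 2 * (real n + 1)" by (simp add: powr_realpow powr_add)
  then have "real (2 ^ log_bits n) \<le> real (2 * n + 2)" by simp
  then have "2 ^ log_bits n \<le> 2 * n + 2" by (simp only: of_nat_le_iff)
  also have "\<dots> \<le> 2 * 2 * n" using assms by simp
  also have "\<dots> \<le> n * n * n" using assms by (intro mult_mono) auto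
  finally show ?thesis by (simp add: power3_eq_cube)
qed

text \<open>
  At the start of level \<open>j\<close> of the algorithm there are at most \<open>size_bound\<close> active vertices, of degree at most
  \<open>degree_bound\<close> among themselves, and each has at least \<open>palette_bound\<close> colours left.
\<close>

definition size_bound :: "nat \<Rightarrow> nat \<Rightarrow> nat \<Rightarrow> real" where
  "size_bound j n d = n * (2 / root6 d) ^ j"

definition degree_bound :: "nat \<Rightarrow> nat \<Rightarrow> real" where
  "degree_bound j d = d * (2 / root6 d) ^ j"

definition palette_bound :: "nat \<Rightarrow> nat \<Rightarrow> real" where
  "palette_bound j d = root6 d ^ 6 / (4 * root6 d) ^ j"

text \<open>Vertices and degrees shrink by about r per level, so this number of bins keeps each bin
  at about n / r^3 vertices of degree about r^3 on every level.\<close>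

definition bins :: "nat \<Rightarrow> nat \<Rightarrow> nat" where
  "bins j d = root6 d ^ (3 - j)"

text \<open>By \<open>root6\<close> this is below 1 / d, so that the vertices failing at this rate
  have O(n) neighbours altogether.\<close>

definition discard_rate :: "nat \<Rightarrow> real" where
  "discard_rate d = 1 / (real (root6 d) + 1) ^ 6"

text \<open>The palettes are the bottleneck: \<open>palette_bound\<close> divided by bins times r^2
  equals r / 4^j, which is at least r / 16 for j < 3 and dictates \<kappa>. The 256 is 64 * 4, from
  d \<le> 64 r^6 and 2^j \<le> 4.\<close>

lemma level_bounds:
  assumes j: "j < 3" and d: "2 \<le> root6 d" and n: "d < n"
  defines "\<kappa> \<equiv> real (root6 d) / 512"
  shows "4 * \<kappa> \<le> size_bound j n d / bins j d" "4 * \<kappa> \<le> degree_bound j d / bins j d"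
    "4 * \<kappa> \<le> size_bound j n d / root6 d" "4 * \<kappa> \<le> degree_bound j d / root6 d"
    "32 * \<kappa> \<le> palette_bound j d / (bins j d * real (root6 d) ^ 2)"
    "16 * \<kappa> \<le> palette_bound j d / root6 d"
    "size_bound j n d / bins j d \<le> 4 * real n / real (root6 d) ^ 3"
    "degree_bound j d / bins j d \<le> 256 * real (root6 d) ^ 3"
proof -
  define r where "r = real (root6 d)"
  have r: "2 \<le> r" "r ^ 6 \<le> d" "real d \<le> 64 * r ^ 6"
  proof -
    show "2 \<le> r" using d by (simp add: r_def)
    have "real (root6 d ^ 6) \<le> real d" using root6(2)[of d] by (simp only: of_nat_le_iff)
    then show "r ^ 6 \<le> d" by (simp add: r_def)
    have "d \<le> 64 * root6 d ^ 6" using d root6(1)[of d] root6_succ_le[of d] by linarith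
    then have "real d \<le> real (64 * root6 d ^ 6)" by (simp only: of_nat_le_iff)
    then show "real d \<le> 64 * r ^ 6" by (simp add: r_def)
  qed
  have qj: "real (bins j d) * r ^ j = r ^ 3" "real (bins j d) > 0"
    using j r(1) by (auto simp: bins_def r_def power_add[symmetric])
  have q: "x * (2 / r) ^ j / bins j d = x * 2 ^ j / r ^ 3" for x
    unfolding qj(1)[symmetric] using r(1) qj(2) by (simp add: power_divide field_simps)
  have two: "1 \<le> (2::real) ^ j" "(2::real) ^ j \<le> 4" "(4::real) ^ j \<le> 16"
    using j power_increasing[of j 2 "2::real"] power_increasing[of j 2 "4::real"] by auto
  have r3: "r \<le> r ^ 3" using r(1) power_increasing[of 1 3 r] by simp
  have r63: "r ^ 6 / r ^ 3 = r ^ 3" using r(1) by (simp add: divide_eq_eq flip: power_add)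
  have big: "4 * \<kappa> \<le> x * (2 / r) ^ j / bins j d" "4 * \<kappa> \<le> x * (2 / r) ^ j / r" if x: "r ^ 6 \<le> x" for x
  proof -
    have "0 \<le> r ^ 6" using r(1) by (intro zero_le_power) simp
    with x have x0: "0 \<le> x" by (rule order_trans[rotated])
    have "4 * \<kappa> \<le> r ^ 3" using r(1) r3 by (simp add: \<kappa>_def r_def[symmetric])
    also have "\<dots> = r ^ 6 / r ^ 3" by (rule r63[symmetric])
    also have "\<dots> \<le> x / r ^ 3" using r(1) by (intro divide_right_mono[OF x]) auto
    finally have *: "4 * \<kappa> \<le> x / r ^ 3" .
    also have "\<dots> \<le> x * 2 ^ j / r ^ 3" using two x0 r(1) by (intro divide_right_mono) (auto simp: mult_le_cancel_left1)
    finally show "4 * \<kappa> \<le> x * (2 / r) ^ j / bins j d" by (simp add: q)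
    have "x / r ^ 3 \<le> x / r ^ Suc j" using j r(1) x0 by (intro divide_left_mono power_increasing) auto
    also have "\<dots> \<le> x * 2 ^ j / r ^ Suc j" using two x0 r(1) by (intro divide_right_mono) (auto simp: mult_le_cancel_left1)
    also have "\<dots> = x * (2 / r) ^ j / r" using r(1) by (simp add: power_divide)
    finally show "4 * \<kappa> \<le> x * (2 / r) ^ j / r" using * by simp
  qed
  show "4 * \<kappa> \<le> size_bound j n d / bins j d" "4 * \<kappa> \<le> degree_bound j d / bins j d"
    "4 * \<kappa> \<le> size_bound j n d / root6 d" "4 * \<kappa> \<le> degree_bound j d / root6 d"
    unfolding size_bound_def degree_bound_def r_def[symmetric]
    using r n by (intro big; simp)+
  have "32 * \<kappa> = r / 16" by (simp add: \<kappa>_def r_def)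
  also have "\<dots> \<le> r / 4 ^ j" using r(1) two by (intro divide_left_mono) auto
  also have "\<dots> = r ^ 6 / (4 ^ j * (r ^ 3 * r ^ 2))" using r(1) by (simp add: field_simps flip: power_add power_Suc)
  also have "\<dots> = palette_bound j d / (bins j d * real (root6 d) ^ 2)"
    unfolding qj(1)[symmetric] palette_bound_def r_def[symmetric]
    by (simp add: power_mult_distrib mult_ac r_def)
  finally show "32 * \<kappa> \<le> palette_bound j d / (bins j d * real (root6 d) ^ 2)" .
  have "16 * \<kappa> \<le> r ^ 3 / 16" using r(1) r3 by (simp add: \<kappa>_def r_def[symmetric])
  also have "\<dots> = r ^ 6 / r ^ 3 / 16" by (simp only: r63)
  also have "\<dots> = r ^ 6 / (16 * r ^ 3)" by simp
  also have "\<dots> \<le> r ^ 6 / (4 ^ j * r ^ Suc j)"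
    using r(1) j two by (intro divide_left_mono mult_mono power_increasing) auto
  also have "\<dots> = palette_bound j d / root6 d"
    unfolding palette_bound_def r_def[symmetric] by (simp add: power_mult_distrib mult_ac r_def)
  finally show "16 * \<kappa> \<le> palette_bound j d / root6 d" .
  show "size_bound j n d / bins j d \<le> 4 * real n / real (root6 d) ^ 3"
    unfolding size_bound_def r_def[symmetric] q
    using r(1) two mult_left_mono[OF two(2), of "real n"] by (intro divide_right_mono) auto
  have "degree_bound j d / bins j d = real d * 2 ^ j / r ^ 3"
    unfolding degree_bound_def r_def[symmetric] q ..
  also have "\<dots> \<le> (64 * r ^ 6) * 4 / r ^ 3"
    using r(1,3) two by (intro divide_right_mono mult_mono) auto
  also have "\<dots> = 256 * (r ^ 6 / r ^ 3)" by simp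
  also have "\<dots> = 256 * r ^ 3" by (simp only: r63)
  finally show "degree_bound j d / bins j d \<le> 256 * real (root6 d) ^ 3" by (simp add: r_def)
qed

text \<open>The exponential decay in r beats the number of bins times (r + 1)^6. The threshold
  \<open>r0\<close> separates large from bounded degrees; being uniform in j it serves all
  levels.\<close>

lemma eventually_discard_rate:
  "\<exists>r0\<ge>2. \<forall>d j. r0 \<le> root6 d \<longrightarrow> (4 * real (bins j d) + 3) * exp (- (real (root6 d) / 512)) \<le> discard_rate d"
proof -
  have "eventually (\<lambda>r::nat. (4 * real r ^ 3 + 3) * exp (- (real r / 512)) \<le> 1 / (real r + 1) ^ 6) at_top"
    by real_asymp
  then obtain r0 where r0: "\<And>r. r0 \<le> r \<Longrightarrow>
      (4 * real r ^ 3 + 3) * exp (- (real r / 512)) \<le> 1 / (real r + 1) ^ 6"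
    by (auto simp: eventually_sequentially)
  show ?thesis
  proof (intro exI[of _ "max r0 2"] conjI allI impI)
    fix d j assume d: "max r0 2 \<le> root6 d"
    have "real (bins j d) \<le> real (root6 d) ^ 3"
      unfolding bins_def of_nat_power using d by (intro power_increasing) auto
    then have "(4 * real (bins j d) + 3) * exp (- (real (root6 d) / 512))
        \<le> (4 * real (root6 d) ^ 3 + 3) * exp (- (real (root6 d) / 512))"
      by (intro mult_right_mono) auto
    also have "\<dots> \<le> discard_rate d" using r0[of "root6 d"] d by (simp add: discard_rate_def)
    finally show "(4 * real (bins j d) + 3) * exp (- (real (root6 d) / 512)) \<le> discard_rate d" .
  qed simp
qed

definition is_hash_family ::
  "nat \<Rightarrow> nat \<Rightarrow> nat \<Rightarrow> nat \<Rightarrow> 'a set \<Rightarrow> ('a \<Rightarrow> nat \<Rightarrow> nat) \<Rightarrow> bool" where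
  "is_hash_family X j n d J F \<longleftrightarrow>
     (\<forall>U S P. U \<subseteq> {..<X} \<longrightarrow> S \<subseteq> {..<X} \<longrightarrow> P \<subseteq> {..<X} \<longrightarrow> card U \<le> size_bound j n d \<longrightarrow>
        card S \<le> degree_bound j d \<longrightarrow> card S < card P \<longrightarrow> palette_bound j d \<le> card P \<longrightarrow>
        card {s \<in> J. \<not> good_hash (bins j d) (root6 d) (size_bound j n d) (degree_bound j d)
           (palette_bound j d) U S P (F s)} \<le> 4 * discard_rate d * card J)"

text \<open>The universe has size at most n^(3 e), the inverse of \<open>discard_rate d\<close> is
  at most 64 n, and 3 * 64 < n^2. Together these account for the exponent 3 e + 3.\<close>

lemma ex_is_hash_family:
  assumes "j < 3" "2 \<le> root6 d" "d < n" "finite J" "card J = n ^ (3 * e + 3)"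
    and "(4 * real (bins j d) + 3) * exp (- (real (root6 d) / 512)) \<le> discard_rate d"
  shows "\<exists>F. is_hash_family (2 ^ (e * log_bits n)) j n d J F"
proof -
  let ?X = "2 ^ (e * log_bits n) :: nat"
  have "(2::nat) ^ 6 \<le> root6 d ^ 6" using assms(2) by (intro power_mono) auto
  then have n: "64 < n" using root6(2)[of d] assms(3) by simp
  have "?X = (2 ^ log_bits n) ^ e" by (simp add: power_mult[symmetric] mult.commute)
  also have "\<dots> \<le> (n ^ 3) ^ e" using two_power_log_bits_le[of n] n by (intro power_mono) auto
  also have "\<dots> = n ^ (3 * e)" by (simp add: power_mult)
  finally have X: "?X \<le> n ^ (3 * e)" .
  have "(root6 d + 1) ^ 6 \<le> 64 * n"
    using root6_succ_le[of d] root6(2)[of d] assms(2,3) by linarith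
  then have "3 * ?X * (root6 d + 1) ^ 6 \<le> 3 * n ^ (3 * e) * (64 * n)"
    using X by (intro mult_mono) auto
  also have "\<dots> = 192 * (n ^ (3 * e) * n)" by simp
  also have "\<dots> < n * n * (n ^ (3 * e) * n)"
  proof (rule mult_strict_right_mono)
    have "192 < 64 * (64::nat)" by simp
    also have "\<dots> \<le> n * n" using n by (intro mult_mono) auto
    finally show "192 < n * n" .
  qed (use n in simp)
  also have "\<dots> = card J" unfolding assms(5) by (simp add: power_add power3_eq_cube)
  finally have "real (3 * ?X * (root6 d + 1) ^ 6) < real (card J)" by (simp only: of_nat_less_iff)
  then have J: "3 * real ?X < discard_rate d * card J"
    by (simp add: discard_rate_def field_simps)
  note b = level_bounds[OF assms(1-3)]
  have "0 < bins j d" using assms(2) by (simp add: bins_def)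
  from ex_hash_family[OF _ assms(2) this b(1,2,3,4,5,6) assms(6,4) J]
  show ?thesis unfolding is_hash_family_def by simp
qed

text \<open>Uncoloured vertices outside \<open>U\<close> are those at which some hash function
  failed. The last condition allows each level a further share of
  \<open>4 * discard_rate\<close>.\<close>

definition invariant :: "nat \<Rightarrow> input \<Rightarrow> (nat \<Rightarrow> nat option) \<Rightarrow> nat set \<Rightarrow> bool" where
  "invariant j I c U \<longleftrightarrow> partial_proper I c \<and> U \<subseteq> verts I \<and> (\<forall>v\<in>U. c v = None) \<and>
     card U \<le> size_bound j (card (verts I)) (max_deg I) \<and>
     (\<forall>v\<in>U. card (nbhd I v \<inter> U) \<le> degree_bound j (max_deg I) \<and>
        palette_bound j (max_deg I) \<le> card (residual I c v)) \<and>
     card {v \<in> verts I. c v = None \<and> v \<notin> U} \<le>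
       4 * real j * discard_rate (max_deg I) * card (verts I)"

section \<open>One level of the algorithm\<close>

context colouring_inputs
begin

text \<open>Each coloured neighbour costs at most one of the \<open>max_deg I + 1\<close> colours,
  so any partial colouring leaves the greedy condition intact.\<close>

lemma card_uncoloured_less_residual:
  assumes I: "I \<in> \<I>" and v: "v \<in> verts I"
  shows "card {w \<in> nbhd I v. c w = None} < card (residual I c v)"
proof -
  let ?C = "{w \<in> nbhd I v. c w \<noteq> None}"
  note fin = nbhd_props(2)[OF I, of v]
  have "pal I v \<subseteq> residual I c v \<union> (\<lambda>w. the (c w)) ` ?C"
    by (force simp: residual_def)
  then have "card (pal I v) \<le> card (residual I c v \<union> (\<lambda>w. the (c w)) ` ?C)"
    using fin finite_subset[OF residual_subset pal_props(3)[OF I v]] by (intro card_mono) auto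
  also have "\<dots> \<le> card (residual I c v) + card ?C"
  proof -
    have "finite ?C" using fin by simp
    then show ?thesis
      using card_Un_le[of "residual I c v" "(\<lambda>w. the (c w)) ` ?C"] card_image_le[of ?C "\<lambda>w. the (c w)"]
      by linarith
  qed
  finally have "max_deg I + 1 \<le> card (residual I c v) + card ?C" by (simp add: pal_props[OF I v])
  moreover have "card {w \<in> nbhd I v. c w = None} + card ?C = card (nbhd I v)"
    using fin by (subst card_Un_disjoint[symmetric]) (auto intro: arg_cong[of _ _ card])
  ultimately show ?thesis using card_nbhd_le[OF I v] by linarith
qed

lemma computable_residual:
  assumes "computable \<I> (\<lambda>I v. c I)"
  shows "computable \<I> (\<lambda>I v. residual I (c I) v)"
  using computable_map3[OF assms computable_nbhd computable_pal, where
      h = "\<lambda>c N P. {x \<in> P. \<forall>w\<in>N. c w \<noteq> Some x}"]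
  by (simp add: residual_def)

text \<open>A set of vertices whose induced graph fits into O(n) words forms a single bin, with the
  whole residual palettes as lists.\<close>

lemma computable_finish:
  assumes c: "computable \<I> (\<lambda>I v. c I)" and U: "computable \<I> (\<lambda>I v. U I)"
    and proper: "\<And>I. I \<in> \<I> \<Longrightarrow> partial_proper I (c I)"
    and sub: "\<And>I v. I \<in> \<I> \<Longrightarrow> v \<in> U I \<Longrightarrow> v \<in> verts I \<and> c I v = None"
    and load: "\<And>I. I \<in> \<I> \<Longrightarrow> (\<Sum>v\<in>U I. 2 * card (nbhd I v \<inter> U I) + 1) \<le> k * card (verts I)"
  shows "\<exists>c'. computable \<I> (\<lambda>I v. c' I) \<and> (\<forall>I\<in>\<I>. partial_proper I (c' I) \<and>
    (\<forall>v. v \<notin> U I \<longrightarrow> c' I v = c I v) \<and> (\<forall>v\<in>U I. c' I v \<noteq> None))"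
proof -
  define bin where "bin I v = (if v \<in> U I then Some (0::nat) else None)" for I v
  have bm: "binmates I (bin I) v = nbhd I v \<inter> U I" if "v \<in> U I" for I v
    using that by (auto simp: binmates_def bin_def split: if_splits)
  have "\<exists>c'. computable \<I> (\<lambda>I v. c' I) \<and> (\<forall>I\<in>\<I>. partial_proper I (c' I) \<and>
      (\<forall>v. bin I v = None \<longrightarrow> c' I v = c I v) \<and> (\<forall>v. bin I v \<noteq> None \<longrightarrow> c' I v \<noteq> None))"
  proof (rule computable_extend_colouring[OF c _ computable_residual[OF c] proper])
    show "computable \<I> (\<lambda>I v. bin I)"
      using computable_map[OF U, where h = "\<lambda>U v. if v \<in> U then Some 0 else None"]
      by (simp add: bin_def[abs_def])
  next
    fix I v i assume I: "I \<in> \<I>" and i: "bin I v = Some i"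
    then have v: "v \<in> U I" "i = 0" by (auto simp: bin_def split: if_splits)
    have "nbhd I v \<inter> U I \<subseteq> {w \<in> nbhd I v. c I w = None}" using sub[OF I] by auto
    then have "card (nbhd I v \<inter> U I) \<le> card {w \<in> nbhd I v. c I w = None}"
      using nbhd_props(2)[OF I] by (intro card_mono) auto
    also have "\<dots> < card (residual I (c I) v)"
      using sub[OF I v(1)] by (intro card_uncoloured_less_residual I) simp
    finally show "v \<in> verts I \<and> i < card (verts I) \<and> c I v = None \<and>
        residual I (c I) v \<subseteq> residual I (c I) v \<and>
        card (binmates I (bin I) v) < card (residual I (c I) v)"
      using sub[OF I v(1)] adm_simps(3)[OF I] v(2) bm[OF v(1)] by simp
  next
    fix I i assume I: "I \<in> \<I>"
    show "(\<Sum>v | bin I v = Some i. 2 * card (binmates I (bin I) v) + 1) \<le> k * card (verts I)"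
    proof (cases "i = 0")
      case True
      then have "{v. bin I v = Some i} = U I" by (auto simp: bin_def)
      then have "(\<Sum>v | bin I v = Some i. 2 * card (binmates I (bin I) v) + 1) =
          (\<Sum>v\<in>U I. 2 * card (nbhd I v \<inter> U I) + 1)"
        by (intro sum.cong) (simp_all add: bm)
      then show ?thesis using load[OF I] by simp
    next
      case False
      then have "{v. bin I v = Some i} = {}" by (auto simp: bin_def)
      then show ?thesis by simp
    qed
  qed (auto simp: bin_def split: if_splits)
  then show ?thesis by (auto simp: bin_def)
qed

text \<open>Vertices hashed to a bin are coloured, those hashed to leftover values form
  \<open>U'\<close>, and those at which the chosen function fails are given up. Giving up a vertex
  does no harm to the others: it only lowers their degrees within the bins.\<close>

lemma computable_level:
  assumes j: "j < 3" and r0: "2 \<le> r0"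
    "\<And>d. r0 \<le> root6 d \<Longrightarrow>
      (4 * real (bins j d) + 3) * exp (- (real (root6 d) / 512)) \<le> discard_rate d"
    and large: "\<And>I. I \<in> \<I> \<Longrightarrow> r0 \<le> root6 (max_deg I)"
    and c: "computable \<I> (\<lambda>I v. c I)" and U: "computable \<I> (\<lambda>I v. U I)"
    and inv: "\<And>I. I \<in> \<I> \<Longrightarrow> invariant j I (c I) (U I)"
  shows "\<exists>c' U'. computable \<I> (\<lambda>I v. c' I) \<and> computable \<I> (\<lambda>I v. U' I) \<and>
    (\<forall>I\<in>\<I>. invariant (Suc j) I (c' I) (U' I))"
proof -
  \<comment> \<open>The exponent a + b of the universe accommodates identifiers and colours alike;
    this seed length provides the number of seeds that \<open>ex_is_hash_family\<close> asks
    for.\<close>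
  define e where "e = 3 * (a + b) + 3"
  define X where "X n = (2::nat) ^ ((a + b) * log_bits n)" for n
  \<comment> \<open>The choice depends on public data only, so all vertices use the same family
    without communicating it.\<close>
  define Fam where "Fam V d = (SOME F. is_hash_family (X (card V)) j (card V) d (seeds V e) F)"
    for V :: "nat set" and d
  let ?n = "\<lambda>I. card (verts I)" and ?d = max_deg
  let ?good = "\<lambda>n d. good_hash (bins j d) (root6 d) (size_bound j n d) (degree_bound j d) (palette_bound j d)"
  define S where "S I v = nbhd I v \<inter> U I" for I v
  define P where "P I v = residual I (c I) v" for I v
  define bad where "bad I v s \<longleftrightarrow> v \<in> U I \<and>
      \<not> ?good (?n I) (?d I) (U I) (S I v) (P I v) (Fam (verts I) (?d I) s)" for I v s
  note V = computable_verts[OF adm]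
  have cP: "computable \<I> P" using computable_residual[OF c] by (simp add: P_def[abs_def])
  have cS: "computable \<I> S"
    using computable_map2[OF computable_nbhd U, where h = "(\<inter>)"] by (simp add: S_def[abs_def])
  have cbad: "computable \<I> bad"
    using computable_map4[OF computable_pair[OF V computable_max_deg] U
        computable_pair[OF cS cP] computable_id, where h = "\<lambda>(V, d) U (S, P) v s. v \<in> U \<and>
          \<not> ?good (card V) d U S P (Fam V d s)"]
    by (simp add: bad_def[abs_def])
  obtain p where p: "computable \<I> (\<lambda>I v. p I)" and
    p_good: "\<And>I. I \<in> \<I> \<Longrightarrow> card {v \<in> verts I. bad I v (p I)} * ?n I ^ e
       \<le> (\<Sum>v\<in>verts I. card {s \<in> seeds (verts I) e. bad I v s})"
    using computable_good_seed[OF adm cbad, of e] by blast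
  define h where "h I = Fam (verts I) (?d I) (p I)" for I
  define vb where "vb I v = vertex_bin (root6 (?d I)) (h I) v" for I v
  define G where "G I = {v \<in> U I. \<not> bad I v (p I)}" for I
  define bin where "bin I v = (if v \<in> G I \<and> vb I v < bins j (?d I) then Some (vb I v) else None)" for I v
  define Q where "Q I v = {x \<in> P I v. colour_bin (root6 (?d I)) (h I) x = vb I v}" for I v
  define U' where "U' I = {v \<in> G I. bins j (?d I) \<le> vb I v}" for I
  note inv = inv[unfolded invariant_def]
  have UV: "U I \<subseteq> verts I" if "I \<in> \<I>" for I using inv[OF that] by blast
  have finU: "finite (U I)" if "I \<in> \<I>" for I
    using UV[OF that] adm_simps(1)[OF that] finite_subset by blast
  have ch: "computable \<I> (\<lambda>I v. h I)"
    using computable_map3[OF V computable_max_deg p, where h = Fam] by (simp add: h_def)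
  have cvb: "computable \<I> (\<lambda>I v. vb I)"
    using computable_map2[OF computable_max_deg ch, where h = "\<lambda>d h. vertex_bin (root6 d) h"]
    by (simp add: vb_def[abs_def])
  have "computable \<I> (\<lambda>I v. v \<in> U I \<and> \<not> bad I v (p I))"
    using computable_map4[OF U cbad p computable_id, where h = "\<lambda>U b p v. v \<in> U \<and> \<not> b p"] .
  from computable_broadcast[OF adm small_bool this]
  have "computable \<I> (\<lambda>I u. \<lambda>v\<in>verts I. v \<in> U I \<and> \<not> bad I v (p I))" by simp
  from computable_map2[OF V this, where h = "\<lambda>V g. {v \<in> V. g v}"]
  have cG: "computable \<I> (\<lambda>I v. G I)"
    by (rule computable_cong) (use UV in \<open>auto simp: G_def\<close>)
  have cbin: "computable \<I> (\<lambda>I v. bin I)"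
    using computable_map3[OF cG cvb computable_max_deg, where
        h = "\<lambda>G f d v. if v \<in> G \<and> f v < bins j d then Some (f v) else None"]
    by (simp add: bin_def[abs_def])
  have cQ: "computable \<I> Q"
    using computable_map4[OF cP computable_pair[OF computable_max_deg ch] cvb computable_id, where
        h = "\<lambda>P (d, h) f v. {x \<in> P. colour_bin (root6 d) h x = f v}"]
    by (simp add: Q_def[abs_def])
  have cU': "computable \<I> (\<lambda>I v. U' I)"
    using computable_map3[OF cG cvb computable_max_deg, where h = "\<lambda>G f d. {v \<in> G. bins j d \<le> f v}"]
    by (simp add: U'_def)
  have SU: "S I v \<subseteq> {w \<in> nbhd I v. c I w = None}" if "I \<in> \<I>" for I v
    using inv[OF that] by (auto simp: S_def)
  have SP: "card (S I v) < card (P I v)" if I: "I \<in> \<I>" and v: "v \<in> verts I" for I v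
  proof -
    have "card (S I v) \<le> card {w \<in> nbhd I v. c I w = None}"
      using SU[OF I] nbhd_props(2)[OF I] by (intro card_mono) auto
    also have "\<dots> < card (P I v)" unfolding P_def by (rule card_uncoloured_less_residual[OF I v])
    finally show ?thesis .
  qed
  have finS: "finite (S I v)" if "I \<in> \<I>" for I v using nbhd_props(2)[OF that] by (simp add: S_def)
  have good: "?good (?n I) (?d I) (U I) (S I v) (P I v) (h I)" if "v \<in> G I" for I v
    using that by (auto simp: G_def bad_def h_def)
  have few_bad: "card {v \<in> verts I. bad I v (p I)} \<le> 4 * discard_rate (?d I) * ?n I"
    if I: "I \<in> \<I>" for I
  proof -
    let ?J = "seeds (verts I) e"
    note V = adm_simps[OF I]
    have d: "2 \<le> root6 (?d I)" "r0 \<le> root6 (?d I)" using r0(1) large[OF I] by auto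
    have "\<exists>F. is_hash_family (X (?n I)) j (?n I) (?d I) ?J F"
      unfolding X_def
      by (rule ex_is_hash_family[OF j d(1) max_deg_less[OF I] _ _ r0(2)[OF d(2)]])
        (use V in \<open>auto simp: finite_seeds card_seeds e_def\<close>)
    note fam = someI_ex[OF this, folded Fam_def, unfolded is_hash_family_def, rule_format]
    have sub: "verts I \<subseteq> {..<X (?n I)}" "pal I v \<subseteq> {..<X (?n I)}" if "v \<in> verts I" for v
    proof -
      have "2 ^ (a * log_bits (?n I)) \<le> X (?n I)" "2 ^ (b * log_bits (?n I)) \<le> X (?n I)"
        unfolding X_def by (intro power_increasing; simp)+
      then show "verts I \<subseteq> {..<X (?n I)}" "pal I v \<subseteq> {..<X (?n I)}"
        using V(4) pal_props(2)[OF I that] by (meson lessThan_subset_iff order_trans)+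
    qed
    have "card {s \<in> ?J. bad I v s} \<le> 4 * discard_rate (?d I) * card ?J" if v: "v \<in> verts I" for v
    proof (cases "v \<in> U I")
      case True
      then have "{s \<in> ?J. bad I v s} =
          {s \<in> ?J. \<not> ?good (?n I) (?d I) (U I) (S I v) (P I v) (Fam (verts I) (?d I) s)}"
        by (auto simp: bad_def)
      moreover have "U I \<subseteq> {..<X (?n I)}" "S I v \<subseteq> {..<X (?n I)}" "P I v \<subseteq> {..<X (?n I)}"
        using UV[OF I] sub[OF v] residual_subset[of I "c I" v] unfolding S_def P_def by blast+
      ultimately show ?thesis
        using fam[of "U I" "S I v" "P I v"] SP[OF I v] inv[OF I] True by (simp add: S_def P_def)
    next
      case False
      then show ?thesis by (simp add: bad_def discard_rate_def)
    qed
    then have le: "(\<Sum>v\<in>verts I. real (card {s \<in> ?J. bad I v s})) \<le>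
        (\<Sum>v\<in>verts I. 4 * discard_rate (?d I) * card ?J)" by (rule sum_mono)
    have "real (card {v \<in> verts I. bad I v (p I)}) * real (?n I) ^ e =
        real (card {v \<in> verts I. bad I v (p I)} * ?n I ^ e)" by simp
    also have "\<dots> \<le> real (\<Sum>v\<in>verts I. card {s \<in> ?J. bad I v s})"
      using p_good[OF I] by (simp only: of_nat_le_iff)
    also have "\<dots> = (\<Sum>v\<in>verts I. real (card {s \<in> ?J. bad I v s}))" by (rule of_nat_sum)
    also note le
    also have "(\<Sum>v\<in>verts I. 4 * discard_rate (?d I) * card ?J) =
        (4 * discard_rate (?d I) * ?n I) * real (?n I) ^ e"
      by (simp add: card_seeds[OF V(1)])
    finally have "real (card {v \<in> verts I. bad I v (p I)}) * real (?n I) ^ e \<le>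
        (4 * discard_rate (?d I) * ?n I) * real (?n I) ^ e" .
    then show ?thesis by (rule mult_right_le_imp_le) (use V in simp)
  qed
  \<comment> \<open>The bounds on \<open>U I\<close> do not involve v, so a single good vertex
    establishes them for all; without one there is nothing to colour.\<close>
  have bound: "card {u \<in> U I. vb I u = i} \<le> 2 * size_bound j (?n I) (?d I) * (1 / bins j (?d I))"
    "card {u \<in> S I v. vb I u = i} \<le> 2 * degree_bound j (?d I) * (1 / bins j (?d I))"
    "card {u \<in> S I v. vb I u = i} < card {x \<in> P I v. colour_bin (root6 (?d I)) (h I) x = i}"
    if "v \<in> G I" "i < bins j (?d I)" for I v i
    using good[OF that(1)] that(2) by (simp_all add: good_hash_def vb_def)
  have bound_left: "card {u \<in> U I. bins j (?d I) \<le> vb I u} \<le> size_bound (Suc j) (?n I) (?d I)"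
    "card {u \<in> S I v. bins j (?d I) \<le> vb I u} \<le> degree_bound (Suc j) (?d I)"
    "card (P I v) \<le> 2 * card (S I v) \<Longrightarrow>
      palette_bound (Suc j) (?d I) \<le> card {u \<in> S I v. bins j (?d I) \<le> vb I u}"
    if "v \<in> G I" for I v
    using good[OF that]
    by (simp_all add: good_hash_def vb_def size_bound_def degree_bound_def palette_bound_def mult_ac)
  have bin_Some: "v \<in> G I" "vb I v = i" "i < bins j (?d I)" if "bin I v = Some i" for I v i
    using that by (auto simp: bin_def split: if_splits)
  have GU: "G I \<subseteq> U I" for I by (auto simp: G_def)
  have binmates: "card (binmates I (bin I) v) \<le> card {u \<in> S I v. vb I u = i}"
    if I: "I \<in> \<I>" and v: "bin I v = Some i" for I v i
  proof (rule card_mono)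
    show "finite {u \<in> S I v. vb I u = i}" using finS[OF I] by simp
    show "binmates I (bin I) v \<subseteq> {u \<in> S I v. vb I u = i}"
    proof
      fix w assume "w \<in> binmates I (bin I) v"
      then have w: "w \<in> nbhd I v" "bin I w = Some i" using v by (simp_all add: binmates_def)
      then show "w \<in> {u \<in> S I v. vb I u = i}"
        using bin_Some(1,2)[OF w(2)] subsetD[OF GU] by (simp add: S_def)
    qed
  qed
  have "\<exists>c'. computable \<I> (\<lambda>I v. c' I) \<and> (\<forall>I\<in>\<I>. partial_proper I (c' I) \<and>
      (\<forall>v. bin I v = None \<longrightarrow> c' I v = c I v) \<and> (\<forall>v. bin I v \<noteq> None \<longrightarrow> c' I v \<noteq> None))"
  \<comment> \<open>A bin has at most 8 n / r^3 vertices, each sending at most 1024 r^3 + 1 words;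
    this makes 8192 n + 8 n / r^3.\<close>
  proof (rule computable_extend_colouring[OF c cbin cQ, where k = 8200])
    show "partial_proper I (c I)" if "I \<in> \<I>" for I using inv[OF that] by blast
  next
    fix I v i assume I: "I \<in> \<I>" and v: "bin I v = Some i"
    note b = bin_Some[OF v]
    have vU: "v \<in> U I" using b(1) GU by blast
    \<comment> \<open>Each bin is collected by a vertex of its own, so there must be fewer than n
      bins.\<close>
    have "bins j (?d I) \<le> root6 (?d I) ^ 6"
      unfolding bins_def using r0(1) large[OF I] by (intro power_increasing) auto
    also have "\<dots> < ?n I" using root6(2)[of "?d I"] max_deg_less[OF I] by linarith
    finally have "i < ?n I" using b(3) by simp
    moreover have "card (binmates I (bin I) v) < card (Q I v)"
      using binmates[OF I v] bound(3)[OF b(1,3)] by (simp add: Q_def b(2))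
    moreover have "Q I v \<subseteq> residual I (c I) v" by (auto simp: Q_def P_def)
    ultimately show "v \<in> verts I \<and> i < card (verts I) \<and> c I v = None \<and>
        Q I v \<subseteq> residual I (c I) v \<and> card (binmates I (bin I) v) < card (Q I v)"
      using inv[OF I] vU by blast
  next
    fix I v w i k assume "bin I v = Some i" "bin I w = Some k" "i \<noteq> k"
    then show "Q I v \<inter> Q I w = {}" using bin_Some by (auto simp: Q_def)
  next
    fix I i assume I: "I \<in> \<I>"
    let ?B = "{v. bin I v = Some i}" and ?q = "real (bins j (?d I))" and ?r = "real (root6 (?d I))"
    let ?N = "size_bound j (?n I) (?d I)" and ?K = "degree_bound j (?d I)"
    have d: "2 \<le> root6 (?d I)" using r0(1) large[OF I] by auto
    note lb = level_bounds(7,8)[OF j d max_deg_less[OF I]]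
    show "(\<Sum>v | bin I v = Some i. 2 * card (binmates I (bin I) v) + 1) \<le> 8200 * ?n I"
    proof (cases "?B = {}")
      case False
      then obtain v0 where "bin I v0 = Some i" by auto
      note b = bin_Some[OF this]
      have "?B \<subseteq> {u \<in> U I. vb I u = i}" using bin_Some(1,2) subsetD[OF GU] by blast
      then have "card ?B \<le> card {u \<in> U I. vb I u = i}"
        using finU[OF I] by (intro card_mono) auto
      then have cB: "card ?B \<le> 2 * (?N / ?q)" using bound(1)[OF b(1,3)] by simp
      have "real (\<Sum>v\<in>?B. 2 * card (binmates I (bin I) v) + 1) =
          (\<Sum>v\<in>?B. 2 * real (card (binmates I (bin I) v)) + 1)"
        by (simp add: add.commute)
      also have "\<dots> \<le> (\<Sum>v\<in>?B. 4 * (?K / ?q) + 1)"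
      proof (rule sum_mono)
        fix v assume "v \<in> ?B"
        then have v: "bin I v = Some i" by simp
        show "2 * real (card (binmates I (bin I) v)) + 1 \<le> 4 * (?K / ?q) + 1"
          using binmates[OF I v] bound(2)[OF bin_Some(1)[OF v] b(3)] by simp
      qed
      also have "\<dots> = card ?B * (4 * (?K / ?q) + 1)" by simp
      also have "\<dots> \<le> (2 * (4 * ?n I / ?r ^ 3)) * (4 * (256 * ?r ^ 3) + 1)"
        using cB lb by (intro mult_mono add_mono) (auto simp: degree_bound_def)
      also have "\<dots> = 8192 * ?n I + 8 * ?n I / ?r ^ 3" using d by (simp add: field_simps)
      also have "8 * ?n I / ?r ^ 3 \<le> 8 * ?n I / 1"
        using d by (intro divide_left_mono one_le_power) auto
      finally have "real (\<Sum>v\<in>?B. 2 * card (binmates I (bin I) v) + 1) \<le> real (8200 * ?n I)" by simp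
      then show ?thesis by (simp only: of_nat_le_iff)
    qed simp
  qed
  then obtain c' where cc': "computable \<I> (\<lambda>I v. c' I)" and
    c': "\<And>I. I \<in> \<I> \<Longrightarrow> partial_proper I (c' I)"
      "\<And>I v. I \<in> \<I> \<Longrightarrow> bin I v = None \<Longrightarrow> c' I v = c I v"
      "\<And>I v. I \<in> \<I> \<Longrightarrow> bin I v \<noteq> None \<Longrightarrow> c' I v \<noteq> None" by blast
  have "invariant (Suc j) I (c' I) (U' I)" if I: "I \<in> \<I>" for I
    unfolding invariant_def
  proof (intro conjI ballI)
    let ?r = "real (root6 (?d I))"
    have U'G: "U' I \<subseteq> G I" by (auto simp: U'_def)
    show "partial_proper I (c' I)" by (rule c'(1)[OF I])
    show "U' I \<subseteq> verts I" using U'G GU[of I] UV[OF I] by blast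
    have bin_U': "bin I v = None" if "v \<in> U' I" for v using that by (simp add: bin_def U'_def)
    show "c' I v = None" if "v \<in> U' I" for v
    proof -
      have "v \<in> U I" using that U'G GU[of I] by blast
      then show ?thesis using c'(2)[OF I bin_U'[OF that]] inv[OF I] by metis
    qed
    show "card (U' I) \<le> size_bound (Suc j) (?n I) (?d I)"
    proof (cases "U' I = {}")
      case False
      then obtain v where "v \<in> G I" using U'G by blast
      have "card (U' I) \<le> card {u \<in> U I. bins j (?d I) \<le> vb I u}"
        using finU[OF I] GU[of I] by (intro card_mono) (auto simp: U'_def)
      then show ?thesis using bound_left(1)[OF \<open>v \<in> G I\<close>] by linarith
    qed (simp add: size_bound_def)
    fix v assume v: "v \<in> U' I"
    then have vG: "v \<in> G I" "v \<in> U I" "v \<in> verts I" using U'G GU[of I] UV[OF I] by blast+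
    have "card (nbhd I v \<inter> U' I) \<le> card {u \<in> S I v. bins j (?d I) \<le> vb I u}"
    proof (rule card_mono)
      show "finite {u \<in> S I v. bins j (?d I) \<le> vb I u}" using finS[OF I] by simp
      show "nbhd I v \<inter> U' I \<subseteq> {u \<in> S I v. bins j (?d I) \<le> vb I u}"
        using GU[of I] by (auto simp: U'_def S_def)
    qed
    then show "card (nbhd I v \<inter> U' I) \<le> degree_bound (Suc j) (?d I)"
      using bound_left(2)[OF vG(1)] by linarith
    let ?W = "{w \<in> nbhd I v. bin I w \<noteq> None}"
    let ?L = "{u \<in> S I v. bins j (?d I) \<le> vb I u}" and ?M = "{u \<in> S I v. vb I u < bins j (?d I)}"
    have finW: "finite ?W" using nbhd_props(2)[OF I] by simp
    \<comment> \<open>A colour is lost only to a neighbour that was coloured on this level.\<close>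
    have "P I v \<subseteq> residual I (c' I) v \<union> (\<lambda>w. the (c' I w)) ` ?W"
    proof
      fix x assume x: "x \<in> P I v"
      show "x \<in> residual I (c' I) v \<union> (\<lambda>w. the (c' I w)) ` ?W"
      proof (cases "x \<in> residual I (c' I) v")
        case False
        then obtain w where w: "w \<in> nbhd I v" "c' I w = Some x"
          using x by (auto simp: residual_def P_def)
        moreover have "c I w \<noteq> Some x" using x w(1) by (simp add: residual_def P_def)
        ultimately have "bin I w \<noteq> None" using c'(2)[OF I, of w] by metis
        then show ?thesis using w by force
      qed simp
    qed
    then have "card (P I v) \<le> card (residual I (c' I) v \<union> (\<lambda>w. the (c' I w)) ` ?W)"
      using finW finite_subset[OF residual_subset pal_props(3)[OF I vG(3)]] by (intro card_mono) auto
    also have "\<dots> \<le> card (residual I (c' I) v) + card ?W"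
      using card_Un_le[of "residual I (c' I) v" "(\<lambda>w. the (c' I w)) ` ?W"]
        card_image_le[OF finW, of "\<lambda>w. the (c' I w)"] by linarith
    also have "card ?W \<le> card ?M"
    proof (rule card_mono)
      show "finite ?M" using finS[OF I] by simp
      show "?W \<subseteq> ?M"
      proof
        fix w assume "w \<in> ?W"
        then obtain i where w: "w \<in> nbhd I v" "bin I w = Some i" by auto
        then show "w \<in> ?M" using bin_Some[OF w(2)] subsetD[OF GU] by (simp add: S_def)
      qed
    qed
    finally have 1: "card (P I v) \<le> card (residual I (c' I) v) + card ?M" by simp
    have "card ?L + card ?M = card (S I v)"
      using finS[OF I] by (subst card_Un_disjoint[symmetric]) (auto intro: arg_cong[of _ _ card])
    \<comment> \<open>The leftover neighbours \<open>?L\<close> take no colour, so at least |P| -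
      |S| + |L| colours remain.\<close>
    with 1 have 2: "card (P I v) + card ?L \<le> card (residual I (c' I) v) + card (S I v)" by linarith
    note 3 = SP[OF I vG(3)]
    show "palette_bound (Suc j) (?d I) \<le> card (residual I (c' I) v)"
    \<comment> \<open>Either the hash function guarantees many leftover neighbours, and |P| > |S|;
      or |P| > 2 |S|, and at least half of the palette survives.\<close>
    proof (cases "card (P I v) \<le> 2 * card (S I v)")
      case True
      from bound_left(3)[OF vG(1) this] 2 3 show ?thesis by linarith
    next
      case False
      have r: "2 \<le> ?r" using r0(1) large[OF I] by auto
      have p0: "0 \<le> palette_bound j (?d I)" by (simp add: palette_bound_def)
      have "palette_bound (Suc j) (?d I) = palette_bound j (?d I) / (4 * ?r)"
        by (simp add: palette_bound_def mult_ac)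
      also have "\<dots> \<le> palette_bound j (?d I) / 2" using r p0 by (intro divide_left_mono) auto
      also have "\<dots> \<le> card (P I v) / 2" using inv[OF I] vG(2) by (simp add: P_def)
      also have "\<dots> \<le> card (residual I (c' I) v)" using False 2 by linarith
      finally show ?thesis .
    qed
  next
    let ?O = "{v \<in> verts I. c I v = None \<and> v \<notin> U I}" and ?B = "{v \<in> verts I. bad I v (p I)}"
    have "{v \<in> verts I. c' I v = None \<and> v \<notin> U' I} \<subseteq> ?O \<union> ?B"
    proof
      fix v assume "v \<in> {v \<in> verts I. c' I v = None \<and> v \<notin> U' I}"
      then have v: "v \<in> verts I" "c' I v = None" "v \<notin> U' I" by auto
      then have "bin I v = None" using c'(3)[OF I, of v] by blast
      moreover from this have "c I v = None" using c'(2)[OF I] v by simp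
      ultimately show "v \<in> ?O \<union> ?B" using v by (auto simp: bin_def U'_def G_def split: if_splits)
    qed
    then have "card {v \<in> verts I. c' I v = None \<and> v \<notin> U' I} \<le> card (?O \<union> ?B)"
      using adm_simps(1)[OF I] by (intro card_mono) auto
    also have "\<dots> \<le> card ?O + card ?B" by (rule card_Un_le)
    finally have "real (card {v \<in> verts I. c' I v = None \<and> v \<notin> U' I}) \<le> real (card ?O) + real (card ?B)"
      by linarith
    also have "\<dots> \<le> 4 * real j * discard_rate (?d I) * ?n I + 4 * discard_rate (?d I) * ?n I"
      using few_bad[OF I] inv[OF I] by (intro add_mono) auto
    also have "\<dots> = 4 * real (Suc j) * discard_rate (?d I) * ?n I" by (simp add: algebra_simps)
    finally show "card {v \<in> verts I. c' I v = None \<and> v \<notin> U' I} \<le>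
        4 * real (Suc j) * discard_rate (?d I) * ?n I" .
  qed
  then show ?thesis using cc' cU' by blast
qed

end

section \<open>The whole algorithm\<close>

context colouring_inputs
begin

lemma computable_colouring_large:
  assumes r0: "2 \<le> r0"
    "\<And>d j. r0 \<le> root6 d \<Longrightarrow>
      (4 * real (bins j d) + 3) * exp (- (real (root6 d) / 512)) \<le> discard_rate d"
    and large: "\<And>I. I \<in> \<I> \<Longrightarrow> r0 \<le> root6 (max_deg I)"
  shows "\<exists>c. computable \<I> (\<lambda>I v. c I) \<and>
    (\<forall>I\<in>\<I>. partial_proper I (c I) \<and> (\<forall>v\<in>verts I. c I v \<noteq> None))"
proof -
  have levels: "j \<le> 3 \<Longrightarrow> \<exists>c U. computable \<I> (\<lambda>I v. c I) \<and> computable \<I> (\<lambda>I v. U I) \<and>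
    (\<forall>I\<in>\<I>. invariant j I (c I) (U I))" for j
  proof (induction j)
    case 0
    have "invariant 0 I (\<lambda>_. None) (verts I)" if I: "I \<in> \<I>" for I
    proof -
      have "nbhd I v \<inter> verts I = nbhd I v" for v using nbhd_props(1)[OF I] by blast
      moreover have "root6 (max_deg I) ^ 6 \<le> max_deg I + 1" using root6(2)[of "max_deg I"] by simp
      then have "real (root6 (max_deg I) ^ 6) \<le> real (max_deg I + 1)" by (simp only: of_nat_le_iff)
      ultimately show ?thesis using card_nbhd_le[OF I]
        by (auto simp: invariant_def partial_proper_def residual_def size_bound_def
            degree_bound_def palette_bound_def pal_props(1)[OF I])
    qed
    then show ?case
      by (intro exI[of _ "\<lambda>_ _. None"] exI[of _ verts] conjI computable_verts[OF adm]
          computable_const) blast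
  next
    case (Suc j)
    then obtain c U where "computable \<I> (\<lambda>I v. c I)" "computable \<I> (\<lambda>I v. U I)"
      "\<And>I. I \<in> \<I> \<Longrightarrow> invariant j I (c I) (U I)" by auto
    from computable_level[OF _ r0 large this] Suc.prems show ?case by auto
  qed
  obtain c U where c: "computable \<I> (\<lambda>I v. c I)" and U: "computable \<I> (\<lambda>I v. U I)"
    and inv: "\<And>I. I \<in> \<I> \<Longrightarrow> invariant 3 I (c I) (U I)"
    using levels[of 3] by auto
  have r: "2 \<le> root6 (max_deg I)" if "I \<in> \<I>" for I using r0(1) large[OF that] by simp
  note inv = inv[unfolded invariant_def]
  have "\<exists>c'. computable \<I> (\<lambda>I v. c' I) \<and> (\<forall>I\<in>\<I>. partial_proper I (c' I) \<and>
    (\<forall>v. v \<notin> U I \<longrightarrow> c' I v = c I v) \<and> (\<forall>v\<in>U I. c' I v \<noteq> None))"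
  \<comment> \<open>At most 8 n / r^3 vertices remain, of degree at most 512 r^3, so the load is
    again at most 8192 n + 8 n / r^3.\<close>
  proof (rule computable_finish[OF c U, where k = 8200])
    fix I assume I: "I \<in> \<I>"
    show "partial_proper I (c I)" using inv[OF I] by blast
    show "v \<in> verts I \<and> c I v = None" if "v \<in> U I" for v using inv[OF I] that by blast
    let ?r = "real (root6 (max_deg I))" and ?n = "real (card (verts I))"
    have r2: "2 \<le> ?r" using r[OF I] by simp
    have "max_deg I \<le> 64 * root6 (max_deg I) ^ 6"
      using root6(1)[of "max_deg I"] root6_succ_le[of "max_deg I"] r[OF I] by linarith
    then have "real (max_deg I) \<le> real (64 * root6 (max_deg I) ^ 6)" by (simp only: of_nat_le_iff)
    then have "degree_bound 3 (max_deg I) \<le> (64 * ?r ^ 6) * (2 / ?r) ^ 3"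
      unfolding degree_bound_def by (intro mult_right_mono) auto
    also have "\<dots> = 512 * (?r ^ 6 / ?r ^ 3)" by (simp add: power_divide)
    also have "?r ^ 6 / ?r ^ 3 = ?r ^ 3" using r2 by (simp add: divide_eq_eq flip: power_add)
    finally have K: "degree_bound 3 (max_deg I) \<le> 512 * ?r ^ 3" .
    have N: "size_bound 3 (card (verts I)) (max_deg I) = 8 * ?n / ?r ^ 3"
      by (simp add: size_bound_def power_divide)
    have "real (\<Sum>v\<in>U I. 2 * card (nbhd I v \<inter> U I) + 1) = (\<Sum>v\<in>U I. 2 * real (card (nbhd I v \<inter> U I)) + 1)"
      by (simp add: add.commute)
    also have "\<dots> \<le> (\<Sum>v\<in>U I. 2 * (512 * ?r ^ 3) + 1)"
    proof (rule sum_mono)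
      fix v assume "v \<in> U I"
      then have "card (nbhd I v \<inter> U I) \<le> degree_bound 3 (max_deg I)" using inv[OF I] by blast
      then show "2 * real (card (nbhd I v \<inter> U I)) + 1 \<le> 2 * (512 * ?r ^ 3) + 1" using K by linarith
    qed
    also have "\<dots> = card (U I) * (1024 * ?r ^ 3 + 1)" by simp
    also have "\<dots> \<le> (8 * ?n / ?r ^ 3) * (1024 * ?r ^ 3 + 1)"
      using inv[OF I] unfolding N[symmetric] by (intro mult_right_mono) auto
    also have "\<dots> = 8192 * ?n + 8 * ?n / ?r ^ 3" using r2 by (simp add: field_simps)
    also have "8 * ?n / ?r ^ 3 \<le> 8 * ?n / 1"
      using r2 by (intro divide_left_mono one_le_power) auto
    finally have "real (\<Sum>v\<in>U I. 2 * card (nbhd I v \<inter> U I) + 1) \<le> real (8200 * card (verts I))" by simp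
    then show "(\<Sum>v\<in>U I. 2 * card (nbhd I v \<inter> U I) + 1) \<le> 8200 * card (verts I)"
      by (simp only: of_nat_le_iff)
  qed
  then obtain c1 where c1: "computable \<I> (\<lambda>I v. c1 I)"
    "\<And>I. I \<in> \<I> \<Longrightarrow> partial_proper I (c1 I)" "\<And>I v. I \<in> \<I> \<Longrightarrow> v \<notin> U I \<Longrightarrow> c1 I v = c I v"
    "\<And>I v. I \<in> \<I> \<Longrightarrow> v \<in> U I \<Longrightarrow> c1 I v \<noteq> None" by blast
  define W where "W I = {v \<in> verts I. c1 I v = None}" for I
  have cW: "computable \<I> (\<lambda>I v. W I)"
    using computable_map2[OF computable_verts[OF adm] c1(1), where h = "\<lambda>V c. {v \<in> V. c v = None}"]
    by (simp add: W_def)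
  have "\<exists>c'. computable \<I> (\<lambda>I v. c' I) \<and> (\<forall>I\<in>\<I>. partial_proper I (c' I) \<and>
    (\<forall>v. v \<notin> W I \<longrightarrow> c' I v = c1 I v) \<and> (\<forall>v\<in>W I. c' I v \<noteq> None))"
  \<comment> \<open>The three levels give up at most 12 * \<open>discard_rate\<close> * n vertices,
    and the full neighbourhood of a vertex costs at most 2 (r + 1)^6 words.\<close>
  proof (rule computable_finish[OF c1(1) cW c1(2), where k = 24])
    fix I assume I: "I \<in> \<I>"
    show "v \<in> verts I \<and> c1 I v = None" if "v \<in> W I" for v using that by (simp add: W_def)
    let ?n = "real (card (verts I))"
    have "W I \<subseteq> {v \<in> verts I. c I v = None \<and> v \<notin> U I}"
    proof
      fix v assume v: "v \<in> W I"
      then have "v \<notin> U I" using c1(4)[OF I, of v] by (auto simp: W_def)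
      then show "v \<in> {v \<in> verts I. c I v = None \<and> v \<notin> U I}"
        using v c1(3)[OF I, of v] by (simp add: W_def)
    qed
    then have "card (W I) \<le> card {v \<in> verts I. c I v = None \<and> v \<notin> U I}"
      using adm_simps(1)[OF I] by (intro card_mono) auto
    moreover have "card {v \<in> verts I. c I v = None \<and> v \<notin> U I} \<le>
        4 * real 3 * discard_rate (max_deg I) * ?n" using inv[OF I] by blast
    ultimately have cW: "card (W I) \<le> 12 * discard_rate (max_deg I) * ?n" by simp
    have "2 * card (nbhd I v \<inter> W I) + 1 \<le> 2 * (root6 (max_deg I) + 1) ^ 6" if "v \<in> W I" for v
    proof -
      have "card (nbhd I v \<inter> W I) \<le> card (nbhd I v)"
        using nbhd_props(2)[OF I] by (intro card_mono) auto
      also have "\<dots> \<le> max_deg I" using that by (intro card_nbhd_le I) (simp add: W_def)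
      finally show ?thesis using root6(1)[of "max_deg I"] by linarith
    qed
    then have "(\<Sum>v\<in>W I. 2 * card (nbhd I v \<inter> W I) + 1) \<le> card (W I) * (2 * (root6 (max_deg I) + 1) ^ 6)"
      using sum_mono[of "W I" "\<lambda>v. 2 * card (nbhd I v \<inter> W I) + 1"
          "\<lambda>_. 2 * (root6 (max_deg I) + 1) ^ 6"] by simp
    then have "real (\<Sum>v\<in>W I. 2 * card (nbhd I v \<inter> W I) + 1) \<le>
        real (card (W I) * (2 * (root6 (max_deg I) + 1) ^ 6))" by (simp only: of_nat_le_iff)
    also have "\<dots> = real (card (W I)) * (2 * (real (root6 (max_deg I)) + 1) ^ 6)"
      by (simp add: add.commute)
    also have "\<dots> \<le> (12 * discard_rate (max_deg I) * ?n) * (2 * (real (root6 (max_deg I)) + 1) ^ 6)"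
      using cW by (intro mult_right_mono) auto
    also have "\<dots> = 24 * ?n * (discard_rate (max_deg I) * (real (root6 (max_deg I)) + 1) ^ 6)" by simp
    also have "discard_rate (max_deg I) * (real (root6 (max_deg I)) + 1) ^ 6 = 1"
      by (simp add: discard_rate_def)
    finally have "real (\<Sum>v\<in>W I. 2 * card (nbhd I v \<inter> W I) + 1) \<le> real (24 * card (verts I))" by simp
    then show "(\<Sum>v\<in>W I. 2 * card (nbhd I v \<inter> W I) + 1) \<le> 24 * card (verts I)"
      by (simp only: of_nat_le_iff)
  qed
  then obtain c2 where c2: "computable \<I> (\<lambda>I v. c2 I)"
    "\<And>I. I \<in> \<I> \<Longrightarrow> partial_proper I (c2 I)" "\<And>I v. I \<in> \<I> \<Longrightarrow> v \<notin> W I \<Longrightarrow> c2 I v = c1 I v"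
    "\<And>I v. I \<in> \<I> \<Longrightarrow> v \<in> W I \<Longrightarrow> c2 I v \<noteq> None" by blast
  have "c2 I v \<noteq> None" if "I \<in> \<I>" "v \<in> verts I" for I v
  proof (cases "v \<in> W I")
    case False
    then show ?thesis using c2(3)[OF that(1)] that(2) by (simp add: W_def)
  qed (rule c2(4)[OF that(1)])
  with c2(1,2) show ?thesis by blast
qed

lemma computable_colouring_small:
  assumes "\<And>I. I \<in> \<I> \<Longrightarrow> max_deg I \<le> k"
  shows "\<exists>c. computable \<I> (\<lambda>I v. c I) \<and>
    (\<forall>I\<in>\<I>. partial_proper I (c I) \<and> (\<forall>v\<in>verts I. c I v \<noteq> None))"
proof -
  have "\<exists>c. computable \<I> (\<lambda>I v. c I) \<and> (\<forall>I\<in>\<I>. partial_proper I (c I) \<and>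
    (\<forall>v. v \<notin> verts I \<longrightarrow> c I v = None) \<and> (\<forall>v\<in>verts I. c I v \<noteq> None))"
  proof (rule computable_finish[OF computable_const computable_verts[OF adm], where k = "2 * k + 1"])
    fix I assume I: "I \<in> \<I>"
    have "2 * card (nbhd I v \<inter> verts I) + 1 \<le> 2 * k + 1" if "v \<in> verts I" for v
    proof -
      have "card (nbhd I v \<inter> verts I) \<le> card (nbhd I v)"
        using nbhd_props(2)[OF I] by (intro card_mono) auto
      also have "\<dots> \<le> k" using card_nbhd_le[OF I that] assms[OF I] by simp
      finally show ?thesis by simp
    qed
    then show "(\<Sum>v\<in>verts I. 2 * card (nbhd I v \<inter> verts I) + 1) \<le> (2 * k + 1) * card (verts I)"
      using sum_mono[of "verts I" "\<lambda>v. 2 * card (nbhd I v \<inter> verts I) + 1" "\<lambda>_. 2 * k + 1"]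
      by (simp add: mult.commute)
  qed (auto simp: partial_proper_def)
  then show ?thesis by blast
qed

end

lemma computable_colouring:
  "\<exists>f. computable {I. list_colouring_input a b (fst I) (fst (snd I)) (snd (snd I))} (\<lambda>I v. f I v) \<and>
    (\<forall>V E \<Psi>. list_colouring_input a b V E \<Psi> \<longrightarrow> proper_list_colouring V E \<Psi> (f (V, E, \<Psi>)))"
proof -
  let ?A = "{I. list_colouring_input a b (fst I) (fst (snd I)) (snd (snd I))}"
  obtain r0 where r0: "2 \<le> r0" "\<And>d j. r0 \<le> root6 d \<Longrightarrow>
      (4 * real (bins j d) + 3) * exp (- (real (root6 d) / 512)) \<le> discard_rate d"
    using eventually_discard_rate by blast
  define L where "L = {I \<in> ?A. r0 \<le> root6 (max_deg I)}"
  define S where "S = {I \<in> ?A. root6 (max_deg I) < r0}"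
  have LS: "L \<union> S = ?A" by (auto simp: L_def S_def)
  \<comment> \<open>The locale is needed for the two degree ranges and also for their union, on
    which the vertices have to decide which range applies.\<close>
  interpret A: colouring_inputs ?A a b by standard simp
  interpret L: colouring_inputs L a b by standard (simp add: L_def)
  interpret S: colouring_inputs S a b by standard (simp add: S_def)
  obtain cL where cL: "computable L (\<lambda>I v. cL I)"
    "\<And>I. I \<in> L \<Longrightarrow> partial_proper I (cL I) \<and> (\<forall>v\<in>verts I. cL I v \<noteq> None)"
    using L.computable_colouring_large[OF r0] by (auto simp: L_def)
  have "max_deg I \<le> (r0 + 1) ^ 6" if "I \<in> S" for I
  proof -
    have "max_deg I < (root6 (max_deg I) + 1) ^ 6" by (rule root6(1))
    also have "\<dots> \<le> (r0 + 1) ^ 6" using that by (intro power_mono) (auto simp: S_def)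
    finally show ?thesis by simp
  qed
  from S.computable_colouring_small[OF this]
  obtain cS where cS: "computable S (\<lambda>I v. cS I)"
    "\<And>I. I \<in> S \<Longrightarrow> partial_proper I (cS I) \<and> (\<forall>v\<in>verts I. cS I v \<noteq> None)" by blast
  define c where "c I = (if I \<in> L then cL I else cS I)" for I
  have c: "partial_proper I (c I) \<and> (\<forall>v\<in>verts I. c I v \<noteq> None)" if "I \<in> ?A" for I
  proof (cases "I \<in> L")
    case True
    then show ?thesis using cL(2)[OF True] by (simp add: c_def)
  next
    case False
    with that LS have "I \<in> S" by blast
    then show ?thesis using cS(2)[of I] False by (simp add: c_def)
  qed
  have "computable L (\<lambda>I v. c I)" by (rule computable_cong[OF cL(1)]) (simp add: c_def)
  moreover have "computable S (\<lambda>I v. c I)"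
    by (rule computable_cong[OF cS(1)]) (auto simp: c_def L_def S_def)
  moreover have "computable (L \<union> S) (\<lambda>I v. I \<in> L)"
    unfolding LS
    by (rule computable_cong[OF computable_map[OF A.computable_max_deg, where h = "\<lambda>d. r0 \<le> root6 d"]])
      (simp add: L_def)
  ultimately have "computable (L \<union> S) (\<lambda>I v. c I)" by (rule computable_Un)
  from computable_map2[OF this computable_id, where h = "\<lambda>c v. the (c v)"]
  have "computable ?A (\<lambda>I v. the (c I v))" unfolding LS .
  moreover have "proper_list_colouring V E \<Psi> (\<lambda>v. the (c (V, E, \<Psi>) v))"
    if I: "list_colouring_input a b V E \<Psi>" for V E \<Psi>
  proof -
    let ?I = "(V, E, \<Psi>)"
    have IA: "?I \<in> ?A" using I by simp
    note c = c[OF IA]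
    have col: "c ?I v = Some (the (c ?I v))" if "v \<in> V" for v
      using c that by (auto simp: verts_def)
    show ?thesis
      unfolding proper_list_colouring_def
    proof (intro conjI ballI allI impI)
      show "the (c ?I v) \<in> \<Psi> v" if "v \<in> V" for v
        using c col[OF that] unfolding partial_proper_def pal_def by auto
      fix u v assume uv: "{u, v} \<in> E"
      then have "u \<in> nbhd ?I v" by (simp add: nbhd_def neighbours_def)
      moreover have V: "u \<in> V" "v \<in> V"
        using I uv by (auto simp: list_colouring_input_def simple_graph_def)
      ultimately have "c ?I u \<noteq> c ?I v"
        using c col[OF V(2)] unfolding partial_proper_def by (metis option.distinct(1))
      then show "the (c ?I u) \<noteq> the (c ?I v)" using col[OF V(1)] col[OF V(2)] by metis
    qed
  qed
  ultimately show ?thesis by (intro exI[of _ "\<lambda>I v. the (c I v)"]) simp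
qed

lemma prob_space_coin_space: "prob_space (coin_space V)"
  unfolding coin_space_def by (intro prob_space_PiM measure_pmf.prob_space_axioms)

theorem theorem1p1:
  "\<forall>a b k :: nat. \<exists>(R :: nat) (B :: nat) (A :: algorithm).
     bandwidth_at_most A B \<and>
     (\<forall>V E \<Psi>. list_colouring_input a b V E \<Psi> \<longrightarrow>
        Measurable.pred (coin_space V)
          (\<lambda>\<omega>. proper_list_colouring V E \<Psi> (outcome A R V E \<Psi> \<omega>)) \<and>
        \<P>(\<omega> in coin_space V. proper_list_colouring V E \<Psi> (outcome A R V E \<Psi> \<omega>))
          \<ge> 1 - 1 / real (card V) ^ k)"
proof (intro allI)
  fix a b k :: nat
  obtain f where f: "computable {I. list_colouring_input a b (fst I) (fst (snd I)) (snd (snd I))} (\<lambda>I v. f I v)"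
    "\<And>V E \<Psi>. list_colouring_input a b V E \<Psi> \<Longrightarrow> proper_list_colouring V E \<Psi> (f (V, E, \<Psi>))"
    using computable_colouring by blast
  then obtain A R B g where A: "bandwidth_at_most A B"
    "\<And>I \<omega> v. list_colouring_input a b (fst I) (fst (snd I)) (snd (snd I)) \<Longrightarrow> v \<in> verts I \<Longrightarrow>
      g (view A R I \<omega> v) = f I v"
    unfolding computable_def by blast
  define A' where "A' = A\<lparr>final_colour := g\<rparr>"
  have "bandwidth_at_most A' B" using A(1) by (simp add: A'_def bandwidth_at_most_def)
  \<comment> \<open>The colouring is proper for every \<omega>, so the event is the whole
    probability space; this settles both measurability and the bound for any k.\<close>
  moreover have proper: "proper_list_colouring V E \<Psi> (outcome A' R V E \<Psi> \<omega>)"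
    if I: "list_colouring_input a b V E \<Psi>" for V E \<Psi> \<omega>
  proof -
    have "received A' V E \<Psi> \<omega> R v = received A V E \<Psi> \<omega> R v" for v
      by (rule received_cong[where R = R]) (simp_all add: A'_def)
    then have "outcome A' R V E \<Psi> \<omega> v = f (V, E, \<Psi>) v" if "v \<in> V" for v
      using A(2)[of "(V, E, \<Psi>)" v \<omega>] I that
      by (simp add: outcome_def A'_def view_def verts_def)
    moreover have "u \<in> V \<and> v \<in> V" if "{u, v} \<in> E" for u v
      using I that by (auto simp: list_colouring_input_def simple_graph_def)
    ultimately show ?thesis
      using f(2)[OF I] unfolding proper_list_colouring_def by simp
  qed
  ultimately show "\<exists>(R :: nat) (B :: nat) (A :: algorithm). bandwidth_at_most A B \<and>
     (\<forall>V E \<Psi>. list_colouring_input a b V E \<Psi> \<longrightarrow>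
        Measurable.pred (coin_space V)
          (\<lambda>\<omega>. proper_list_colouring V E \<Psi> (outcome A R V E \<Psi> \<omega>)) \<and>
        \<P>(\<omega> in coin_space V. proper_list_colouring V E \<Psi> (outcome A R V E \<Psi> \<omega>))
          \<ge> 1 - 1 / real (card V) ^ k)"
    by (intro exI[of _ R] exI[of _ B] exI[of _ A'])
      (simp add: prob_space.prob_space[OF prob_space_coin_space])
qed

end
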